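(* Let $B$ be an Alexandroff space and let $F$ be any T$_0$-space. Then there exists a canonical bijection between isomorphism classes of fiber bundles over $B$ with fiber $F$ and (natural) isomorphism classes of functors from $B$ to $\mathrm{Aut}(F)$. This bijection is induced by the canonical representation (it sends the class of a fiber bundle $p$ to the class of any functor $\mathcal{E}_p\colon B\to\mathrm{Aut}(F)$ such that $\iota\mathcal{E}_p$ is naturally isomorphic to the canonical representation $\mathcal{D}_p$) and its inverse is induced by the topological Grothendieck construction (it sends the class of a functor $C\colon B\to\mathrm{Aut}(F)$ to the class of the fiber bundle $\pi^{\iota C}_B\colon\int\iota C\to B$), where $\iota\colon\mathrm{Aut}(F)\to\mathbf{Top}$ is the inclusion functor.
   Context: An Alexandroff space is a topological space in which arbitrary intersections of open sets are open. In an Alexandroff space $X$ each $x$ has a minimal open neighbourhood $U_x$, and $x\leq y \iff U_x\subseteq U_y$ defines a preorder; the open sets are exactly the lower sets and $U_x=\{y\in X : y\leq x\}$. An Alexandroff space is thereby identified with a preordered set and regarded as a thin category with a unique arrow (denoted $x\leq y$) from $x$ to $y$ whenever $x\leq y$. $\mathbf{Top}$ is the category of topological spaces and continuous maps. $\mathrm{Aut}(F)$ is the subcategory of $\mathbf{Top}$ with single object $F$ and arrows the self-homeomorphisms of $F$. Topological Grothendieck construction: for a functor $D\colon B\to\mathbf{Top}$ from an Alexandroff space $B$, $\int D=\bigcup_{b\in B}\{b\}\times D(b)$, with the topology having as basis the sets $J_D(b,V)=\bigcup_{v\in U_b}\{v\}\times D(v\leq b)^{-1}(V)$, for $b\in B$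 and $V\subseteq D(b)$ open. The projection $\pi^D_B\colon\int D\to B$ is $\pi^D_B(b,x)=b$. A fiber bundle over $B$ with fiber $F$ is a continuous map $p\colon E\to B$ such that every $b\in B$ has an open neighbourhood $U$ (a trivializing neighbourhood) with a homeomorphism $\varphi_U\colon p^{-1}(U)\to U\times F$ (a trivialization map) commuting with the maps to $U$. Two fiber bundles $p\colon E\to B$, $q\colon E'\to B$ are isomorphic if there is a homeomorphism $\alpha\colon E\to E'$ with $q\alpha=p$. Canonical representation: for a fiber bundle $p\colon E\to B$ with T$_0$ fiber $F$ over an Alexandroff space, the canonical representation is the morphism-inverting functor $\mathcal{D}_p\colon B\to\mathbf{Top}$ with $\mathcal{D}_p(b)=p^{-1}(b)$ and, for $b\leq b'$, $\mathcal{D}_p(b\leq b')$ the composite $p^{-1}(b)\to\{b\}\times F\to\{b'\}\times F\to p^{-1}(b')$, where the first map is the restriction of a trivialization map $\varphi_U$ over a trivializing neighbourhood $U$ of $b'$ (note $b\in U$), the second is $(b,x)\mapsto(b',x)$, and the third is the inverse of the restriction of $\varphi_U$ to $p^{-1}(b')$. It does not depend on the choices of $U$ and $\varphi_U$ since $F$ is T$_0$. *)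

theory Defs
  imports "HOL-Analysis.Analysis"
begin

section \<open>Alexandroff spaces as preordered sets\<close>

text \<open>The intersection with the carrier only matters for the empty family.\<close>

definition alexandroff_space :: "'b topology \<Rightarrow> bool" where
  "alexandroff_space B \<longleftrightarrow>
     (\<forall>\<U>. (\<forall>U\<in>\<U>. openin B U) \<longrightarrow> openin B (topspace B \<inter> \<Inter>\<U>))"

definition min_nbhd :: "'b topology \<Rightarrow> 'b \<Rightarrow> 'b set" where
  "min_nbhd B x = \<Inter>{U. openin B U \<and> x \<in> U}"

definition alex_le :: "'b topology \<Rightarrow> 'b \<Rightarrow> 'b \<Rightarrow> bool" where
  "alex_le B x y \<longleftrightarrow>
     x \<in> topspace B \<and> y \<in> topspace B \<and> min_nbhd B x \<subseteq> min_nbhd B y"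


section \<open>Functors on an Alexandroff space\<close>

text \<open>
  A functor from the thin category of \<open>B\<close> to topological spaces is given by its object part
  and, for each pair \<open>b \<le> b'\<close>, by the function underlying the value at the unique arrow
  from \<open>b\<close> to \<open>b'\<close>. Only the values of the arrow part at pairs \<open>b \<le> b'\<close> and at points of the
  space over \<open>b\<close> carry meaning.
\<close>

record ('b, 'x) top_diagram =
  ob :: "'b \<Rightarrow> 'x topology"
  arr :: "'b \<Rightarrow> 'b \<Rightarrow> 'x \<Rightarrow> 'x"

definition top_functor :: "'b topology \<Rightarrow> ('b, 'x) top_diagram \<Rightarrow> bool" where
  "top_functor B D \<longleftrightarrow>
     (\<forall>b b'. alex_le B b b' \<longrightarrow> continuous_map (ob D b) (ob D b') (arr D b b')) \<and>
     (\<forall>b\<in>topspace B. \<forall>x\<in>topspace (ob D b). arr D b b x = x) \<and>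
     (\<forall>b b' b''. alex_le B b b' \<longrightarrow> alex_le B b' b'' \<longrightarrow>
        (\<forall>x\<in>topspace (ob D b). arr D b b'' x = arr D b' b'' (arr D b b' x)))"

definition natural_family ::
  "'b topology \<Rightarrow> ('b, 'x) top_diagram \<Rightarrow> ('b, 'y) top_diagram \<Rightarrow> ('b \<Rightarrow> 'x \<Rightarrow> 'y) \<Rightarrow> bool" where
  "natural_family B D D' \<alpha> \<longleftrightarrow>
     (\<forall>b b'. alex_le B b b' \<longrightarrow>
        (\<forall>x\<in>topspace (ob D b). \<alpha> b' (arr D b b' x) = arr D' b b' (\<alpha> b x)))"

definition top_naturally_isomorphic ::
  "'b topology \<Rightarrow> ('b, 'x) top_diagram \<Rightarrow> ('b, 'y) top_diagram \<Rightarrow> bool" where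
  "top_naturally_isomorphic B D D' \<longleftrightarrow>
     (\<exists>\<alpha>. (\<forall>b\<in>topspace B. homeomorphic_map (ob D b) (ob D' b) (\<alpha> b)) \<and>
          natural_family B D D' \<alpha>)"

text \<open>
  Since \<open>Aut(F)\<close> has a single object, a functor to it consists of an arrow part only;
  \<open>aut_incl\<close> is composition with the inclusion of \<open>Aut(F)\<close> into topological spaces.
\<close>

definition aut_incl :: "'f topology \<Rightarrow> ('b \<Rightarrow> 'b \<Rightarrow> 'f \<Rightarrow> 'f) \<Rightarrow> ('b, 'f) top_diagram" where
  "aut_incl F C = \<lparr>ob = (\<lambda>_. F), arr = C\<rparr>"

definition aut_functor :: "'b topology \<Rightarrow> 'f topology \<Rightarrow> ('b \<Rightarrow> 'b \<Rightarrow> 'f \<Rightarrow> 'f) \<Rightarrow> bool" where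
  "aut_functor B F C \<longleftrightarrow>
     top_functor B (aut_incl F C) \<and>
     (\<forall>b b'. alex_le B b b' \<longrightarrow> homeomorphic_map F F (C b b'))"

definition aut_naturally_isomorphic ::
  "'b topology \<Rightarrow> 'f topology \<Rightarrow> ('b \<Rightarrow> 'b \<Rightarrow> 'f \<Rightarrow> 'f) \<Rightarrow> ('b \<Rightarrow> 'b \<Rightarrow> 'f \<Rightarrow> 'f) \<Rightarrow> bool" where
  "aut_naturally_isomorphic B F C C' \<longleftrightarrow>
     (\<exists>\<alpha>. (\<forall>b\<in>topspace B. homeomorphic_map F F (\<alpha> b)) \<and>
          natural_family B (aut_incl F C) (aut_incl F C') \<alpha>)"

definition functor_class ::
  "'b topology \<Rightarrow> 'f topology \<Rightarrow> ('b \<Rightarrow> 'b \<Rightarrow> 'f \<Rightarrow> 'f) \<Rightarrow> ('b \<Rightarrow> 'b \<Rightarrow> 'f \<Rightarrow> 'f) set" where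
  "functor_class B F C = {C'. aut_functor B F C' \<and> aut_naturally_isomorphic B F C C'}"

definition functor_classes ::
  "'b topology \<Rightarrow> 'f topology \<Rightarrow> ('b \<Rightarrow> 'b \<Rightarrow> 'f \<Rightarrow> 'f) set set" where
  "functor_classes B F = functor_class B F ` {C. aut_functor B F C}"


section \<open>Topological Grothendieck construction\<close>

definition groth_basic ::
  "'b topology \<Rightarrow> ('b, 'x) top_diagram \<Rightarrow> 'b \<Rightarrow> 'x set \<Rightarrow> ('b \<times> 'x) set" where
  "groth_basic B D b V =
     (\<Union>v\<in>min_nbhd B b. {v} \<times> {x \<in> topspace (ob D v). arr D v b x \<in> V})"

text \<open>
  For a functor \<open>D\<close> the basic sets are closed under finite intersections up to unions, and cover
  the union of the \<open>{b} \<times> D(b)\<close>, so this is a topology with that union as carrier.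
\<close>

definition groth :: "'b topology \<Rightarrow> ('b, 'x) top_diagram \<Rightarrow> ('b \<times> 'x) topology" where
  "groth B D =
     topology (arbitrary union_of
       (\<lambda>W. \<exists>b\<in>topspace B. \<exists>V. openin (ob D b) V \<and> W = groth_basic B D b V))"

definition groth_proj :: "'b \<times> 'x \<Rightarrow> 'b" where
  "groth_proj = fst"


section \<open>Fiber bundles\<close>

definition trivialization ::
  "'e topology \<Rightarrow> 'b topology \<Rightarrow> 'f topology \<Rightarrow> ('e \<Rightarrow> 'b) \<Rightarrow> 'b set \<Rightarrow> ('e \<Rightarrow> 'b \<times> 'f) \<Rightarrow> bool" where
  "trivialization E B F p U \<phi> \<longleftrightarrow>
     homeomorphic_map (subtopology E {e \<in> topspace E. p e \<in> U})
                      (prod_topology (subtopology B U) F) \<phi> \<and>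
     (\<forall>e\<in>topspace E. p e \<in> U \<longrightarrow> fst (\<phi> e) = p e)"

definition fiber_bundle ::
  "'b topology \<Rightarrow> 'f topology \<Rightarrow> 'e topology \<Rightarrow> ('e \<Rightarrow> 'b) \<Rightarrow> bool" where
  "fiber_bundle B F E p \<longleftrightarrow>
     continuous_map E B p \<and>
     (\<forall>b\<in>topspace B. \<exists>U. openin B U \<and> b \<in> U \<and> (\<exists>\<phi>. trivialization E B F p U \<phi>))"

definition bundle_isomorphic ::
  "'e topology \<Rightarrow> ('e \<Rightarrow> 'b) \<Rightarrow> 'd topology \<Rightarrow> ('d \<Rightarrow> 'b) \<Rightarrow> bool" where
  "bundle_isomorphic E p E' q \<longleftrightarrow>
     (\<exists>\<alpha>. homeomorphic_map E E' \<alpha> \<and> (\<forall>e\<in>topspace E. q (\<alpha> e) = p e))"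

text \<open>
  The isomorphism class of a bundle, taken among the bundles whose total space has its points
  in the type \<open>'e\<close>. The bundle itself may live over another type \<open>'d\<close>; this is how the
  Grothendieck construction, with points in \<open>'b \<times> 'f\<close>, determines a class of
  bundles over an arbitrary (large enough) type.
\<close>

definition bundle_class ::
  "'b topology \<Rightarrow> 'f topology \<Rightarrow> 'd topology \<Rightarrow> ('d \<Rightarrow> 'b) \<Rightarrow> ('e topology \<times> ('e \<Rightarrow> 'b)) set" where
  "bundle_class B F E p = {(E', q). fiber_bundle B F E' q \<and> bundle_isomorphic E p E' q}"

definition bundle_classes ::
  "'b topology \<Rightarrow> 'f topology \<Rightarrow> ('e topology \<times> ('e \<Rightarrow> 'b)) set set" where
  "bundle_classes B F =
     (\<lambda>(E :: 'e topology, p). bundle_class B F E p) ` {(E, p). fiber_bundle B F E p}"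


section \<open>Canonical representation\<close>

definition fiber :: "'e topology \<Rightarrow> ('e \<Rightarrow> 'b) \<Rightarrow> 'b \<Rightarrow> 'e set" where
  "fiber E p b = {e \<in> topspace E. p e = b}"

text \<open>
  The trivialization near \<open>b'\<close> is picked by choice; for a T0 fiber over an Alexandroff space
  the resulting map from the fiber over \<open>b \<le> b'\<close> to the fiber over \<open>b'\<close> is independent of it.
\<close>

definition canonical_rep ::
  "'b topology \<Rightarrow> 'f topology \<Rightarrow> 'e topology \<Rightarrow> ('e \<Rightarrow> 'b) \<Rightarrow> ('b, 'e) top_diagram" where
  "canonical_rep B F E p =
     \<lparr>ob = (\<lambda>b. subtopology E (fiber E p b)),
      arr = (\<lambda>b b'.
        let \<phi> = (SOME \<phi>. \<exists>U. openin B U \<and> b' \<in> U \<and> trivialization E B F p U \<phi>)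
        in (\<lambda>e. inv_into (fiber E p b') \<phi> (b', snd (\<phi> e))))\<rparr>"

end

(*
  Let phi be a trivialization near p e' and p e \<le> p e'. Because phi preserves and reflects the
  specialization preorder and F is T0, the points e and e' have the same F-coordinate under phi if and
  only if e is the greatest point of its fibre below e'. So the parallel transport given by the canonical
  representation depends only on the total space and is respected by every bundle isomorphism.
  In the Grothendieck construction of C, (b, x) is transported to (b', C b b' x). Hence a natural
  isomorphism from C to the canonical representation of p is the same thing, fibre by fibre, as a
  bundle isomorphism from the Grothendieck construction of C to p; that a fibrewise
  homeomorphism compatible with transport is a homeomorphism is checked over the minimal neighbourhoods,
  where it becomes a product map. Both inverse bijections follow from this equivalence.
*)

theory Submission
  imports Defs
begin

text \<open>Since \<open>canonical_rep\<close> picks a trivialization separately for each target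
  point, neither its functor laws nor its behaviour under bundle isomorphisms can be read off the
  definition. Describing transport as a relation on points of the total space removes these choices:
  a law such as composition becomes the statement that two horizontal pairs with the same start and
  with ends in the same fibre have the same end. The fibre and the total space need not be
  Alexandroff, so their specialization orders do not determine their topologies. The order serves
  only to identify transport; continuity and openness always come from trivializations. The two maps
  of the bijection are both read off a single relation between a functor \<open>C\<close> and a
  bundle \<open>p\<close>, namely that the Grothendieck construction of \<open>C\<close> is
  isomorphic to \<open>p\<close> over \<open>B\<close>.\<close>

section \<open>Specialization order\<close>

text \<open>Equivalently, \<open>y\<close> lies in the closure of \<open>x\<close>. This is the
  direction in which open sets are lower sets, so that on the base the relation agrees with
  \<open>alex_le\<close>.\<close>

definition spec_le :: "'a topology \<Rightarrow> 'a \<Rightarrow> 'a \<Rightarrow> bool" where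
  "spec_le X x y \<longleftrightarrow>
     x \<in> topspace X \<and> y \<in> topspace X \<and> (\<forall>U. openin X U \<longrightarrow> y \<in> U \<longrightarrow> x \<in> U)"

lemma spec_le_refl: "x \<in> topspace X \<Longrightarrow> spec_le X x x"
  by (simp add: spec_le_def)

lemma spec_le_antisym: "t0_space X \<Longrightarrow> spec_le X x y \<Longrightarrow> spec_le X y x \<Longrightarrow> x = y"
  unfolding spec_le_def t0_space_def by metis

lemma spec_le_continuous_map:
  assumes "continuous_map X Y f" and "spec_le X x y"
  shows "spec_le Y (f x) (f y)"
proof -
  have "f x \<in> U" if "openin Y U" "f y \<in> U" for U
  proof -
    have "openin X {z \<in> topspace X. f z \<in> U}"
      using assms(1) that(1) by (auto simp: continuous_map_def)
    with assms(2) that(2) show ?thesis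
      by (auto simp: spec_le_def)
  qed
  then show ?thesis
    using assms by (auto simp: spec_le_def continuous_map_def)
qed

lemma spec_le_homeomorphic_map:
  assumes "homeomorphic_map X Y f" and "x \<in> topspace X" and "y \<in> topspace X"
  shows "spec_le Y (f x) (f y) \<longleftrightarrow> spec_le X x y"
proof -
  obtain g where g: "homeomorphic_maps X Y f g"
    using assms(1) by (auto simp: homeomorphic_map_maps)
  then show ?thesis
    using spec_le_continuous_map[of X Y f x y] spec_le_continuous_map[of Y X g "f x" "f y"] assms(2,3)
    by (auto simp: homeomorphic_maps_def)
qed

lemma spec_le_subtopology:
  "spec_le (subtopology X S) x y \<longleftrightarrow> x \<in> S \<and> y \<in> S \<and> spec_le X x y"
  unfolding spec_le_def openin_subtopology by auto

text \<open>Both projections are continuous and hence monotone; conversely, an open set around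
  \<open>w\<close> contains an open box around \<open>w\<close>, and this box contains
  \<open>z\<close>.\<close>

lemma spec_le_prod_topology:
  "spec_le (prod_topology X Y) z w \<longleftrightarrow> spec_le X (fst z) (fst w) \<and> spec_le Y (snd z) (snd w)"
  (is "?L \<longleftrightarrow> ?R")
proof
  show "?L \<Longrightarrow> ?R"
    using spec_le_continuous_map[OF continuous_map_fst, of X Y z w]
      spec_le_continuous_map[OF continuous_map_snd, of X Y z w] by simp
next
  assume ?R
  have "z \<in> U" if U: "openin (prod_topology X Y) U" "w \<in> U" for U
  proof -
    obtain G H where "openin X G" "openin Y H" "fst w \<in> G" "snd w \<in> H" "G \<times> H \<subseteq> U"
      using U unfolding openin_prod_topology_alt by (metis prod.collapse)
    moreover from this have "fst z \<in> G" "snd z \<in> H"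
      using \<open>?R\<close> by (auto simp: spec_le_def)
    ultimately show ?thesis
      by (metis mem_Times_iff subsetD)
  qed
  then show ?L
    using \<open>?R\<close> by (simp add: spec_le_def mem_Times_iff)
qed


section \<open>Minimal neighbourhoods\<close>

text \<open>The form in which the Alexandroff hypothesis is used throughout. The carrier is itself
  one of the open sets around \<open>b\<close>, so intersecting with it changes nothing.\<close>

lemma openin_min_nbhd:
  assumes "alexandroff_space B" and "b \<in> topspace B"
  shows "openin B (min_nbhd B b)"
proof -
  have "openin B (topspace B \<inter> \<Inter>{U. openin B U \<and> b \<in> U})"
    using assms(1) by (auto simp: alexandroff_space_def)
  moreover have "topspace B \<inter> \<Inter>{U. openin B U \<and> b \<in> U} = min_nbhd B b"
    using assms(2) by (auto simp: min_nbhd_def)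
  ultimately show ?thesis by simp
qed

lemma mem_min_nbhd_self: "b \<in> min_nbhd B b"
  by (simp add: min_nbhd_def)

lemma min_nbhd_subset: "openin B U \<Longrightarrow> b \<in> U \<Longrightarrow> min_nbhd B b \<subseteq> U"
  by (auto simp: min_nbhd_def)

text \<open>Either side says that \<open>x\<close> lies in every open set around \<open>y\<close>,
  because such a set is then also one around \<open>x\<close>. The base and the total space can thus
  be treated by the same order lemmas.\<close>

lemma alex_le_iff_spec_le: "alex_le B = spec_le B"
  unfolding alex_le_def spec_le_def min_nbhd_def fun_eq_iff by blast

lemma mem_min_nbhd_iff: "b \<in> topspace B \<Longrightarrow> v \<in> min_nbhd B b \<longleftrightarrow> alex_le B v b"
  unfolding alex_le_iff_spec_le spec_le_def min_nbhd_def by auto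

lemma alex_le_refl: "b \<in> topspace B \<Longrightarrow> alex_le B b b"
  by (simp add: alex_le_def)

lemma alex_le_trans: "alex_le B a b \<Longrightarrow> alex_le B b c \<Longrightarrow> alex_le B a c"
  by (auto simp: alex_le_def)

lemma alex_le_open: "alex_le B a b \<Longrightarrow> openin B U \<Longrightarrow> b \<in> U \<Longrightarrow> a \<in> U"
  by (auto simp: alex_le_iff_spec_le spec_le_def)

lemma alex_le_topspace: "alex_le B a b \<Longrightarrow> a \<in> topspace B \<and> b \<in> topspace B"
  by (simp add: alex_le_def)


section \<open>Homeomorphisms over a base\<close>

lemma homeomorphic_map_in_topspace:
  "homeomorphic_map X Y f \<Longrightarrow> x \<in> topspace X \<Longrightarrow> f x \<in> topspace Y"
  using homeomorphic_imp_surjective_map by blast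

text \<open>The preimages of the sets \<open>U\<close> are open covers of both spaces, and
  \<open>f\<close> matches them because it lies over the base. Continuity, openness and surjectivity
  are therefore local; so is injectivity, since points with equal images lie over the same base
  point.\<close>

lemma homeomorphic_map_locally_over:
  assumes p: "continuous_map X B p" and q: "continuous_map Y B q"
    and f: "\<And>x. x \<in> topspace X \<Longrightarrow> q (f x) = p x"
    and loc: "\<And>b. b \<in> topspace B \<Longrightarrow> \<exists>U. openin B U \<and> b \<in> U \<and>
      homeomorphic_map (subtopology X {x \<in> topspace X. p x \<in> U})
                       (subtopology Y {y \<in> topspace Y. q y \<in> U}) f"
  shows "homeomorphic_map X Y f"
proof -
  have loc': "\<exists>U. openin B U \<and> b \<in> U \<and>
      openin X {x \<in> topspace X. p x \<in> U} \<and> openin Y {y \<in> topspace Y. q y \<in> U} \<and>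
      homeomorphic_map (subtopology X {x \<in> topspace X. p x \<in> U})
                       (subtopology Y {y \<in> topspace Y. q y \<in> U}) f" if b: "b \<in> topspace B" for b
  proof -
    obtain U where "openin B U" "b \<in> U"
      "homeomorphic_map (subtopology X {x \<in> topspace X. p x \<in> U})
                       (subtopology Y {y \<in> topspace Y. q y \<in> U}) f"
      using loc[OF b] by blast
    then show ?thesis
      using p q by (intro exI[of _ U]) (simp add: continuous_map_def)
  qed
  have px: "p x \<in> topspace B" if "x \<in> topspace X" for x
    using p that by (auto simp: continuous_map_def)
  have qy: "q y \<in> topspace B" if "y \<in> topspace Y" for y
    using q that by (auto simp: continuous_map_def)
  have fX: "f x \<in> topspace Y" if x: "x \<in> topspace X" for x
  proof -
    obtain U where "p x \<in> U" and hU: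
      "homeomorphic_map (subtopology X {x \<in> topspace X. p x \<in> U})
                       (subtopology Y {y \<in> topspace Y. q y \<in> U}) f"
      using loc'[OF px[OF x]] by blast
    then show ?thesis
      using homeomorphic_map_in_topspace[OF hU, of x] x by simp
  qed
  show ?thesis
  proof (rule bijective_open_imp_homeomorphic_map)
    show "continuous_map X Y f"
      unfolding continuous_map_def
    proof (intro conjI allI impI)
      show "f \<in> topspace X \<rightarrow> topspace Y"
        using fX by blast
      fix W assume W: "openin Y W"
      show "openin X {x \<in> topspace X. f x \<in> W}"
      proof (subst openin_subopen, intro ballI)
        fix x assume x: "x \<in> {x \<in> topspace X. f x \<in> W}"
        then obtain U where U: "p x \<in> U" "openin X {x \<in> topspace X. p x \<in> U}"
            "openin Y {y \<in> topspace Y. q y \<in> U}" and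
          hU: "homeomorphic_map (subtopology X {x \<in> topspace X. p x \<in> U})
                       (subtopology Y {y \<in> topspace Y. q y \<in> U}) f"
          using loc'[OF px] by blast
        have "openin (subtopology Y {y \<in> topspace Y. q y \<in> U}) (W \<inter> {y \<in> topspace Y. q y \<in> U})"
          using W by (auto simp: openin_subtopology)
        with homeomorphic_imp_continuous_map[OF hU]
        have "openin (subtopology X {x \<in> topspace X. p x \<in> U})
            {x \<in> topspace (subtopology X {x \<in> topspace X. p x \<in> U}).
               f x \<in> W \<inter> {y \<in> topspace Y. q y \<in> U}}"
          unfolding continuous_map_def by blast
        then have "openin X {x \<in> topspace (subtopology X {x \<in> topspace X. p x \<in> U}).
               f x \<in> W \<inter> {y \<in> topspace Y. q y \<in> U}}"
          using U(2) by (simp add: openin_open_subtopology)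
        then show "\<exists>T. openin X T \<and> x \<in> T \<and> T \<subseteq> {x \<in> topspace X. f x \<in> W}"
          using x U(1) f fX by (intro exI conjI) auto
      qed
    qed
    show "open_map X Y f"
      unfolding open_map_def
    proof (intro allI impI)
      fix W assume W: "openin X W"
      show "openin Y (f ` W)"
      proof (subst openin_subopen, intro ballI)
        fix y assume "y \<in> f ` W"
        then obtain x where x: "x \<in> W" "y = f x" by blast
        then have xX: "x \<in> topspace X"
          using W openin_subset by blast
        then obtain U where U: "p x \<in> U" "openin X {x \<in> topspace X. p x \<in> U}"
            "openin Y {y \<in> topspace Y. q y \<in> U}" and
          hU: "homeomorphic_map (subtopology X {x \<in> topspace X. p x \<in> U})
                       (subtopology Y {y \<in> topspace Y. q y \<in> U}) f"
          using loc'[OF px] by blast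
        have "openin (subtopology X {x \<in> topspace X. p x \<in> U}) (W \<inter> {x \<in> topspace X. p x \<in> U})"
          using W by (auto simp: openin_subtopology)
        with homeomorphic_imp_open_map[OF hU]
        have "openin (subtopology Y {y \<in> topspace Y. q y \<in> U}) (f ` (W \<inter> {x \<in> topspace X. p x \<in> U}))"
          unfolding open_map_def by blast
        then have "openin Y (f ` (W \<inter> {x \<in> topspace X. p x \<in> U}))"
          using U(3) by (simp add: openin_open_subtopology)
        then show "\<exists>T. openin Y T \<and> y \<in> T \<and> T \<subseteq> f ` W"
          using x U(1) xX by (intro exI conjI) auto
      qed
    qed
    show "f ` topspace X = topspace Y"
    proof
      show "f ` topspace X \<subseteq> topspace Y"
        using fX by blast
      show "topspace Y \<subseteq> f ` topspace X"
      proof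
        fix y assume y: "y \<in> topspace Y"
        then obtain U where U: "q y \<in> U" and
          hU: "homeomorphic_map (subtopology X {x \<in> topspace X. p x \<in> U})
                       (subtopology Y {y \<in> topspace Y. q y \<in> U}) f"
          using loc'[OF qy] by blast
        then have "y \<in> topspace (subtopology Y {y \<in> topspace Y. q y \<in> U})"
          using y by simp
        then show "y \<in> f ` topspace X"
          unfolding homeomorphic_imp_surjective_map[OF hU, symmetric] by auto
      qed
    qed
    show "inj_on f (topspace X)"
    proof (rule inj_onI)
      fix x x' assume x: "x \<in> topspace X" "x' \<in> topspace X" "f x = f x'"
      then have "p x = p x'"
        using f by metis
      obtain U where U: "p x \<in> U" and
          hU: "homeomorphic_map (subtopology X {x \<in> topspace X. p x \<in> U})
                       (subtopology Y {y \<in> topspace Y. q y \<in> U}) f"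
        using loc'[OF px[OF x(1)]] by blast
      show "x = x'"
        using inj_onD[OF homeomorphic_imp_injective_map[OF hU] x(3)] x U \<open>p x = p x'\<close> by simp
    qed
  qed
qed

text \<open>Transport of structure along an injection, used to move a space into another
  type.\<close>

lemma homeomorphic_map_pullback_topology:
  fixes i :: "'a \<Rightarrow> 'c"
  assumes "inj_on i (topspace X)"
  shows "homeomorphic_map X (pullback_topology (i ` topspace X) (inv_into (topspace X) i) X) i"
    (is "homeomorphic_map X ?Y i")
proof -
  have top: "topspace ?Y = i ` topspace X"
    using assms by (auto simp: topspace_pullback_topology)
  have "continuous_map X ?Y i"
    unfolding continuous_map_def
  proof (intro conjI allI impI)
    fix W assume "openin ?Y W"
    then obtain U where U: "openin X U" "W = inv_into (topspace X) i -` U \<inter> i ` topspace X"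
      by (auto simp: openin_pullback_topology)
    then have "{x \<in> topspace X. i x \<in> W} = U"
      using assms openin_subset[OF U(1)] by (auto dest: inj_onD)
    then show "openin X {x \<in> topspace X. i x \<in> W}"
      using U(1) by simp
  qed (use top in auto)
  moreover have "continuous_map ?Y X (inv_into (topspace X) i)"
    using continuous_map_pullback[of X X id "i ` topspace X" "inv_into (topspace X) i"] by simp
  ultimately have "homeomorphic_maps X ?Y i (inv_into (topspace X) i)"
    using assms top by (auto simp: homeomorphic_maps_def)
  then show ?thesis
    by (auto simp: homeomorphic_map_maps)
qed


section \<open>Bundle isomorphisms and trivializations\<close>

lemma bundle_isomorphic_sym:
  assumes "bundle_isomorphic E p E' q"
  shows "bundle_isomorphic E' q E p"
proof -
  obtain \<alpha> where \<alpha>: "homeomorphic_map E E' \<alpha>" "\<forall>e\<in>topspace E. q (\<alpha> e) = p e"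
    using assms by (auto simp: bundle_isomorphic_def)
  then obtain \<beta> where \<beta>: "homeomorphic_maps E E' \<alpha> \<beta>"
    by (auto simp: homeomorphic_map_maps)
  then have "p (\<beta> e) = q e" if "e \<in> topspace E'" for e
    using \<alpha>(2) that by (metis homeomorphic_maps_def homeomorphic_map_in_topspace homeomorphic_maps_map)
  with \<beta> show ?thesis
    unfolding bundle_isomorphic_def homeomorphic_maps_map by blast
qed

lemma bundle_isomorphic_trans:
  assumes "bundle_isomorphic E p E' q" and "bundle_isomorphic E' q E'' r"
  shows "bundle_isomorphic E p E'' r"
proof -
  obtain \<alpha> \<beta> where "homeomorphic_map E E' \<alpha>" "\<forall>e\<in>topspace E. q (\<alpha> e) = p e"
    "homeomorphic_map E' E'' \<beta>" "\<forall>e\<in>topspace E'. r (\<beta> e) = q e"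
    using assms by (auto simp: bundle_isomorphic_def)
  then show ?thesis
    unfolding bundle_isomorphic_def
    by (intro exI[of _ "\<beta> \<circ> \<alpha>"])
       (auto intro: homeomorphic_map_compose simp: homeomorphic_map_in_topspace)
qed

text \<open>\<open>V\<close> may be any subset, open or not. Singletons give the fibres, minimal
  neighbourhoods the charts in which two bundles are compared.\<close>

lemma trivialization_subset:
  assumes "trivialization E B F p U \<phi>" and "V \<subseteq> U"
  shows "trivialization E B F p V \<phi>"
proof -
  have hU: "homeomorphic_map (subtopology E {e \<in> topspace E. p e \<in> U})
                      (prod_topology (subtopology B U) F) \<phi>"
    and fst: "\<And>e. e \<in> topspace E \<Longrightarrow> p e \<in> U \<Longrightarrow> fst (\<phi> e) = p e"
    using assms(1) by (auto simp: trivialization_def)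
  have "homeomorphic_map (subtopology (subtopology E {e \<in> topspace E. p e \<in> U}) {e \<in> topspace E. p e \<in> V})
          (subtopology (prod_topology (subtopology B U) F) (V \<times> topspace F)) \<phi>"
    using fst by (intro homeomorphic_map_subtopologies_alt[OF hU]) (auto simp: mem_Times_iff)
  moreover have "{e \<in> topspace E. p e \<in> U} \<inter> {e \<in> topspace E. p e \<in> V} = {e \<in> topspace E. p e \<in> V}"
    using assms(2) by auto
  moreover have "subtopology (prod_topology (subtopology B U) F) (V \<times> topspace F)
      = prod_topology (subtopology B V) F"
    using assms(2) by (simp add: prod_topology_subtopology(1)[symmetric] subtopology_subtopology Int_absorb1)
  ultimately show ?thesis
    using fst assms(2) by (auto simp: trivialization_def subtopology_subtopology)
qed

lemma homeomorphic_map_snd_fiber: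
  assumes "v \<in> topspace B"
  shows "homeomorphic_map (prod_topology (subtopology B {v}) F) F snd"
proof -
  have "homeomorphic_maps (prod_topology (subtopology B {v}) F) F snd (Pair v)"
    using assms by (auto simp: homeomorphic_maps_def continuous_map_snd continuous_map_pairwise o_def)
  then show ?thesis
    by (auto simp: homeomorphic_map_maps)
qed

text \<open>Restriction to the singleton of \<open>v\<close> leaves a product with a one-point
  space, which \<open>snd\<close> identifies with \<open>F\<close>.\<close>

lemma trivialization_fiber:
  assumes "trivialization E B F p U \<phi>" and "v \<in> U" and "v \<in> topspace B"
  shows "homeomorphic_map (subtopology E (fiber E p v)) F (snd \<circ> \<phi>)"
proof -
  have "trivialization E B F p {v} \<phi>"
    using trivialization_subset assms by blast
  then show ?thesis
    using homeomorphic_map_compose[OF _ homeomorphic_map_snd_fiber[OF assms(3)]]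
    by (auto simp: trivialization_def fiber_def)
qed

lemma topspace_fiber: "topspace (subtopology E (fiber E p b)) = fiber E p b"
  by (auto simp: fiber_def)

text \<open>Passing to a subspace only restricts the specialization order, and on a product it is
  componentwise; the chart carries this description back to \<open>E\<close>.\<close>

lemma trivialization_spec_le:
  assumes "trivialization E B F p U \<phi>"
    and "e \<in> topspace E" and "e' \<in> topspace E" and "p e \<in> U" and "p e' \<in> U"
  shows "spec_le E e e' \<longleftrightarrow> alex_le B (p e) (p e') \<and> spec_le F (snd (\<phi> e)) (snd (\<phi> e'))"
proof -
  have h: "homeomorphic_map (subtopology E {e \<in> topspace E. p e \<in> U})
                      (prod_topology (subtopology B U) F) \<phi>"
    and fst: "fst (\<phi> e) = p e" "fst (\<phi> e') = p e'"
    using assms by (auto simp: trivialization_def)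
  show ?thesis
    using spec_le_homeomorphic_map[OF h, of e e'] assms(2-) fst
    by (simp add: spec_le_subtopology spec_le_prod_topology alex_le_iff_spec_le)
qed

lemma trivialization_bundle_iso:
  assumes \<alpha>: "homeomorphic_map E' E \<alpha>" "\<And>e. e \<in> topspace E' \<Longrightarrow> p (\<alpha> e) = q e"
    and "trivialization E B F p U \<phi>"
  shows "trivialization E' B F q U (\<phi> \<circ> \<alpha>)"
proof -
  have "homeomorphic_map (subtopology E' {e \<in> topspace E'. q e \<in> U})
          (subtopology E {e \<in> topspace E. p e \<in> U}) \<alpha>"
    using \<alpha>(2) by (intro homeomorphic_map_subtopologies_alt[OF \<alpha>(1)]) auto
  then show ?thesis
    using assms(3) \<alpha>(2) homeomorphic_map_in_topspace[OF \<alpha>(1)]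
    by (auto simp: trivialization_def intro: homeomorphic_map_compose)
qed

lemma fiber_bundle_bundle_isomorphic:
  assumes "fiber_bundle B F E p" and "bundle_isomorphic E p E' q"
  shows "fiber_bundle B F E' q"
proof -
  obtain \<alpha> where \<alpha>: "homeomorphic_map E' E \<alpha>" "\<forall>e\<in>topspace E'. p (\<alpha> e) = q e"
    using bundle_isomorphic_sym[OF assms(2)] by (auto simp: bundle_isomorphic_def)
  have "continuous_map E' B (p \<circ> \<alpha>)"
    using assms(1) homeomorphic_imp_continuous_map[OF \<alpha>(1)]
    by (auto simp: fiber_bundle_def intro: continuous_map_compose)
  then have "continuous_map E' B q"
    using \<alpha>(2) by (auto elim: continuous_map_eq)
  moreover have "\<exists>U. openin B U \<and> b \<in> U \<and> (\<exists>\<phi>. trivialization E' B F q U \<phi>)"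
    if b: "b \<in> topspace B" for b
  proof -
    obtain U \<phi> where U: "openin B U" "b \<in> U" "trivialization E B F p U \<phi>"
      using assms(1) b unfolding fiber_bundle_def by blast
    then have "trivialization E' B F q U (\<phi> \<circ> \<alpha>)"
      using \<alpha>(2) by (intro trivialization_bundle_iso[OF \<alpha>(1)]) auto
    with U show ?thesis
      by blast
  qed
  ultimately show ?thesis
    by (simp add: fiber_bundle_def)
qed


section \<open>Horizontal pairs\<close>

text \<open>
  Over a trivializing neighbourhood of \<open>p e'\<close> this says that \<open>e\<close> and \<open>e'\<close> have the same
  \<open>F\<close>-coordinate, but it mentions only the specialization order of the total space: \<open>e\<close> is the
  greatest point of its fibre below \<open>e'\<close>.
\<close>

definition horizontal :: "'e topology \<Rightarrow> ('e \<Rightarrow> 'b) \<Rightarrow> 'e \<Rightarrow> 'e \<Rightarrow> bool" where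
  "horizontal E p e e' \<longleftrightarrow>
     spec_le E e e' \<and> (\<forall>d\<in>topspace E. p d = p e \<longrightarrow> spec_le E d e' \<longrightarrow> spec_le E d e)"

lemma horizontal_topspace: "horizontal E p e e' \<Longrightarrow> e \<in> topspace E \<and> e' \<in> topspace E"
  by (simp add: horizontal_def spec_le_def)

lemma horizontal_refl: "e \<in> topspace E \<Longrightarrow> horizontal E p e e"
  by (simp add: horizontal_def spec_le_refl)

lemma horizontal_alex_le:
  "continuous_map E B p \<Longrightarrow> horizontal E p e e' \<Longrightarrow> alex_le B (p e) (p e')"
  by (simp add: horizontal_def alex_le_iff_spec_le spec_le_continuous_map)

lemma horizontal_bundle_iso:
  assumes "homeomorphic_map E E' \<alpha>" and "\<And>e. e \<in> topspace E \<Longrightarrow> q (\<alpha> e) = p e"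
    and "horizontal E p e e'"
  shows "horizontal E' q (\<alpha> e) (\<alpha> e')"
proof -
  have e: "e \<in> topspace E" "e' \<in> topspace E"
    using horizontal_topspace[OF assms(3)] by auto
  have "spec_le E' d (\<alpha> e)" if d: "d \<in> topspace E'" "q d = q (\<alpha> e)" "spec_le E' d (\<alpha> e')" for d
  proof -
    obtain c where c: "c \<in> topspace E" "d = \<alpha> c"
      using d(1) homeomorphic_imp_surjective_map[OF assms(1)] by blast
    then have "p c = p e" "spec_le E c e'"
      using d assms(2) e spec_le_homeomorphic_map[OF assms(1)] by auto
    then have "spec_le E c e"
      using assms(3) c(1) by (auto simp: horizontal_def)
    then show ?thesis
      using spec_le_homeomorphic_map[OF assms(1) c(1) e(1)] c(2) by simp
  qed
  then show ?thesis
    using assms(3) spec_le_homeomorphic_map[OF assms(1) e] by (auto simp: horizontal_def)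
qed

text \<open>All uses of T0 pass through this equivalence. Only \<open>p e'\<close> is assumed to lie
  in \<open>U\<close>: open sets are lower sets, so \<open>p e\<close> lies there too.\<close>

lemma horizontal_iff:
  assumes F: "t0_space F" and U: "openin B U" and \<phi>: "trivialization E B F p U \<phi>"
    and e: "e \<in> topspace E" "e' \<in> topspace E" and le: "alex_le B (p e) (p e')" and e'U: "p e' \<in> U"
  shows "horizontal E p e e' \<longleftrightarrow> snd (\<phi> e) = snd (\<phi> e')"
proof -
  have eU: "p e \<in> U" and peB: "p e \<in> topspace B" "p e' \<in> topspace B"
    using alex_le_open[OF le U e'U] alex_le_topspace[OF le] by auto
  note sle = trivialization_spec_le[OF \<phi>]
  have h: "homeomorphic_map (subtopology E (fiber E p (p d))) F (snd \<circ> \<phi>)"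
    if "p d = p e \<or> p d = p e'" for d
    using trivialization_fiber[OF \<phi>] eU e'U peB that by metis
  have inF: "snd (\<phi> e) \<in> topspace F" "snd (\<phi> e') \<in> topspace F"
    using homeomorphic_map_in_topspace[OF h] e by (auto simp: topspace_fiber fiber_def)
  show ?thesis
  proof
    assume eq: "snd (\<phi> e) = snd (\<phi> e')"
    show "horizontal E p e e'"
      unfolding horizontal_def
    proof (intro conjI ballI impI)
      show "spec_le E e e'"
        using sle[OF e eU e'U] le eq inF by (simp add: spec_le_refl)
      fix d assume d: "d \<in> topspace E" "p d = p e" "spec_le E d e'"
      then show "spec_le E d e"
        using sle[OF d(1) e(2)] sle[OF d(1) e(1)] eU e'U eq alex_le_refl[OF peB(1)] by simp
    qed
  next
    assume hor: "horizontal E p e e'"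
    \<comment> \<open>The competitor is the point \<open>d\<close> over \<open>p e\<close> with the
      same \<open>F\<close>-coordinate as \<open>e'\<close>. It lies below \<open>e'\<close>, hence
      below \<open>e\<close>, which bounds the coordinate of \<open>e'\<close> by that of
      \<open>e\<close>; the opposite bound comes from \<open>e\<close> lying below
      \<open>e'\<close>.\<close>
    have "snd (\<phi> e') \<in> (snd \<circ> \<phi>) ` fiber E p (p e)"
      using homeomorphic_imp_surjective_map[OF h, of e] inF unfolding topspace_fiber by simp
    then obtain d where d: "d \<in> topspace E" "p d = p e" "snd (\<phi> d) = snd (\<phi> e')"
      by (auto simp: fiber_def)
    then have "spec_le E d e'"
      using sle[OF d(1) e(2)] eU e'U le inF by (simp add: spec_le_refl)
    then have "spec_le E d e"
      using hor d by (auto simp: horizontal_def)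
    then have "spec_le F (snd (\<phi> e')) (snd (\<phi> e))"
      using sle[OF d(1) e(1)] eU d by simp
    moreover have "spec_le F (snd (\<phi> e)) (snd (\<phi> e'))"
      using hor sle[OF e eU e'U] by (simp add: horizontal_def)
    ultimately show "snd (\<phi> e) = snd (\<phi> e')"
      using spec_le_antisym[OF F] by blast
  qed
qed

lemma fiber_bundle_trivialization:
  assumes "fiber_bundle B F E p" and "b \<in> topspace B"
  obtains U \<phi> where "openin B U" and "b \<in> U" and "trivialization E B F p U \<phi>"
  using assms unfolding fiber_bundle_def by blast

lemma fiber_bundle_continuous: "fiber_bundle B F E p \<Longrightarrow> continuous_map E B p"
  by (simp add: fiber_bundle_def)

text \<open>A chart around \<open>p e''\<close> also covers the two smaller base points, and in it
  both hypotheses are equalities of \<open>F\<close>-coordinates.\<close>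

lemma horizontal_trans:
  assumes F: "t0_space F" and E: "fiber_bundle B F E p"
    and "horizontal E p e e'" and "horizontal E p e' e''"
  shows "horizontal E p e e''"
proof -
  have le: "alex_le B (p e) (p e')" "alex_le B (p e') (p e'')"
    using horizontal_alex_le[OF fiber_bundle_continuous[OF E]] assms(3,4) by auto
  have top: "e \<in> topspace E" "e' \<in> topspace E" "e'' \<in> topspace E"
    using horizontal_topspace assms(3,4) by metis+
  obtain U \<phi> where U: "openin B U" "p e'' \<in> U" "trivialization E B F p U \<phi>"
    using fiber_bundle_trivialization[OF E] alex_le_topspace[OF le(2)] by metis
  have "p e' \<in> U"
    using alex_le_open[OF le(2) U(1,2)] .
  then have "snd (\<phi> e) = snd (\<phi> e')" "snd (\<phi> e') = snd (\<phi> e'')"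
    using horizontal_iff[OF F U(1,3)] top le U(2) assms(3,4) by auto
  then show ?thesis
    using horizontal_iff[OF F U(1,3) top(1,3) alex_le_trans[OF le] U(2)] by simp
qed

text \<open>In a chart around the common base point, \<open>e'\<close> and \<open>e''\<close> both
  have the \<open>F\<close>-coordinate of \<open>e\<close>, and a chart is injective on a fibre.
  This replaces independence of the chosen trivialization.\<close>

lemma horizontal_unique:
  assumes F: "t0_space F" and E: "fiber_bundle B F E p"
    and "horizontal E p e e'" and "horizontal E p e e''" and eq: "p e' = p e''"
  shows "e' = e''"
proof -
  have le: "alex_le B (p e) (p e')" "alex_le B (p e) (p e'')"
    using horizontal_alex_le[OF fiber_bundle_continuous[OF E]] assms(3,4) by auto
  have top: "e \<in> topspace E" "e' \<in> topspace E" "e'' \<in> topspace E"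
    using horizontal_topspace assms(3,4) by metis+
  have pB: "p e' \<in> topspace B"
    using alex_le_topspace[OF le(1)] by simp
  obtain U \<phi> where U: "openin B U" "p e' \<in> U" "trivialization E B F p U \<phi>"
    using fiber_bundle_trivialization[OF E pB] .
  have "snd (\<phi> e') = snd (\<phi> e'')"
    using horizontal_iff[OF F U(1,3) top(1)] top le U(2) eq assms(3,4) by metis
  then show ?thesis
    using inj_onD[OF homeomorphic_imp_injective_map[OF trivialization_fiber[OF U(3,2) pB]], of e' e'']
      top eq by (simp add: topspace_fiber fiber_def)
qed


section \<open>The canonical representation\<close>

lemma ob_canonical_rep: "ob (canonical_rep B F E p) b = subtopology E (fiber E p b)"
  by (simp add: canonical_rep_def)

text \<open>Together with \<open>horizontal_unique\<close> this characterizes transport; the chosen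
  trivialization is not unfolded again afterwards.\<close>

lemma canonical_rep_horizontal:
  assumes F: "t0_space F" and E: "fiber_bundle B F E p"
    and le: "alex_le B b b'" and e: "e \<in> fiber E p b"
  shows "arr (canonical_rep B F E p) b b' e \<in> fiber E p b'"
    and "horizontal E p e (arr (canonical_rep B F E p) b b' e)"
proof -
  have bB: "b \<in> topspace B" "b' \<in> topspace B"
    using alex_le_topspace[OF le] by auto
  define \<phi> where "\<phi> = (SOME \<phi>. \<exists>U. openin B U \<and> b' \<in> U \<and> trivialization E B F p U \<phi>)"
  have "\<exists>\<phi> U. openin B U \<and> b' \<in> U \<and> trivialization E B F p U \<phi>"
    using fiber_bundle_trivialization[OF E bB(2)] by metis
  then obtain U where U: "openin B U" "b' \<in> U" "trivialization E B F p U \<phi>"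
    unfolding \<phi>_def using someI_ex[of "\<lambda>\<phi>. \<exists>U. openin B U \<and> b' \<in> U \<and> trivialization E B F p U \<phi>"]
    by blast
  have bU: "b \<in> U"
    using alex_le_open[OF le U(1,2)] .
  let ?d = "arr (canonical_rep B F E p) b b' e"
  have d: "?d = inv_into (fiber E p b') \<phi> (b', snd (\<phi> e))"
    by (simp add: canonical_rep_def \<phi>_def Let_def)
  have "snd (\<phi> e) \<in> topspace F"
    using homeomorphic_map_in_topspace[OF trivialization_fiber[OF U(3) bU bB(1)]] e
    unfolding topspace_fiber by simp
  \<comment> \<open>The fibre over \<open>b'\<close> must contain a preimage of
    \<open>(b', snd (\<phi> e))\<close>, since \<open>inv_into\<close> is unspecified outside the
    image.\<close>
  then have "snd (\<phi> e) \<in> (snd \<circ> \<phi>) ` fiber E p b'"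
    using homeomorphic_imp_surjective_map[OF trivialization_fiber[OF U(3,2) bB(2)]]
    unfolding topspace_fiber by simp
  then obtain c where c: "c \<in> fiber E p b'" "snd (\<phi> c) = snd (\<phi> e)"
    by auto
  then have "\<phi> c = (b', snd (\<phi> e))"
    using U by (auto simp: trivialization_def fiber_def prod_eq_iff)
  then have im: "(b', snd (\<phi> e)) \<in> \<phi> ` fiber E p b'"
    using c(1) by force
  show *: "?d \<in> fiber E p b'"
    unfolding d by (rule inv_into_into[OF im])
  have "snd (\<phi> ?d) = snd (\<phi> e)"
    unfolding d by (simp add: f_inv_into_f[OF im])
  then show "horizontal E p e ?d"
    using * e le U horizontal_iff[OF F U(1,3), of e ?d] by (simp add: fiber_def)
qed

text \<open>In any chart near \<open>b'\<close>, transport is the fibre chart over \<open>b\<close>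
  followed by the inverse of the fibre chart over \<open>b'\<close>.\<close>

lemma homeomorphic_map_canonical_rep:
  assumes F: "t0_space F" and E: "fiber_bundle B F E p" and le: "alex_le B b b'"
  shows "homeomorphic_map (subtopology E (fiber E p b)) (subtopology E (fiber E p b'))
           (arr (canonical_rep B F E p) b b')"
proof -
  let ?d = "arr (canonical_rep B F E p) b b'"
  have bB: "b \<in> topspace B" "b' \<in> topspace B"
    using alex_le_topspace[OF le] by auto
  obtain U \<phi> where U: "openin B U" "b' \<in> U" "trivialization E B F p U \<phi>"
    using fiber_bundle_trivialization[OF E bB(2)] .
  have bU: "b \<in> U"
    using alex_le_open[OF le U(1,2)] .
  obtain g where g: "homeomorphic_maps (subtopology E (fiber E p b')) F (snd \<circ> \<phi>) g"
    using trivialization_fiber[OF U(3,2) bB(2)] by (auto simp: homeomorphic_map_maps)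
  have "homeomorphic_map (subtopology E (fiber E p b)) (subtopology E (fiber E p b')) (g \<circ> (snd \<circ> \<phi>))"
    using homeomorphic_map_compose[OF trivialization_fiber[OF U(3) bU bB(1)]] g
    unfolding homeomorphic_maps_map by blast
  then show ?thesis
  proof (rule homeomorphic_map_eq)
    fix e assume "e \<in> topspace (subtopology E (fiber E p b))"
    then have e: "e \<in> fiber E p b"
      by (simp add: topspace_fiber)
    note d = canonical_rep_horizontal[OF F E le e]
    have "snd (\<phi> e) = snd (\<phi> (?d e))"
      using horizontal_iff[OF F U(1,3), of e "?d e"] d e U(2) le by (simp add: fiber_def)
    moreover have "g (snd (\<phi> (?d e))) = ?d e"
      using g d(1) unfolding homeomorphic_maps_def topspace_fiber by simp
    ultimately show "(g \<circ> (snd \<circ> \<phi>)) e = ?d e"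
      by simp
  qed
qed

section \<open>Functors to Aut(F) representing the canonical representation\<close>

lemma aut_functor_homeomorphic:
  "aut_functor B F C \<Longrightarrow> alex_le B b b' \<Longrightarrow> homeomorphic_map F F (C b b')"
  by (simp add: aut_functor_def)

lemma aut_functor_in_topspace:
  "aut_functor B F C \<Longrightarrow> alex_le B b b' \<Longrightarrow> x \<in> topspace F \<Longrightarrow> C b b' x \<in> topspace F"
  by (meson aut_functor_homeomorphic homeomorphic_map_in_topspace)

lemma aut_functor_id:
  "aut_functor B F C \<Longrightarrow> b \<in> topspace B \<Longrightarrow> x \<in> topspace F \<Longrightarrow> C b b x = x"
  by (simp add: aut_functor_def top_functor_def aut_incl_def)

lemma aut_functor_comp:
  assumes "aut_functor B F C" and "alex_le B b b'" and "alex_le B b' b''" and "x \<in> topspace F"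
  shows "C b' b'' (C b b' x) = C b b'' x"
  using assms unfolding aut_functor_def top_functor_def aut_incl_def by simp

text \<open>A naturality square says that \<open>\<beta> b' (C b b' x)\<close> is the transport of
  \<open>\<beta> b x\<close>; as transport is the unique horizontal partner in the fibre over
  \<open>b'\<close>, the arrow part of \<open>canonical_rep\<close> can be replaced by
  \<open>horizontal\<close>.\<close>

lemma isomorphic_canonical_rep_iff:
  assumes F: "t0_space F" and E: "fiber_bundle B F E p" and C: "aut_functor B F C"
  shows "top_naturally_isomorphic B (aut_incl F C) (canonical_rep B F E p) \<longleftrightarrow>
    (\<exists>\<beta>. (\<forall>b\<in>topspace B. homeomorphic_map F (subtopology E (fiber E p b)) (\<beta> b)) \<and>
         (\<forall>b b'. alex_le B b b' \<longrightarrow>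
            (\<forall>x\<in>topspace F. horizontal E p (\<beta> b x) (\<beta> b' (C b b' x)))))"
proof -
  have "\<beta> b' (C b b' x) = arr (canonical_rep B F E p) b b' (\<beta> b x) \<longleftrightarrow>
      horizontal E p (\<beta> b x) (\<beta> b' (C b b' x))"
    if \<beta>: "\<forall>b\<in>topspace B. homeomorphic_map F (subtopology E (fiber E p b)) (\<beta> b)"
      and le: "alex_le B b b'" and x: "x \<in> topspace F" for \<beta> b b' x
  proof -
    have in_fiber: "\<beta> c y \<in> fiber E p c" if "c \<in> topspace B" "y \<in> topspace F" for c y
      using \<beta> homeomorphic_map_in_topspace that topspace_fiber by metis
    have 1: "\<beta> b x \<in> fiber E p b"
      using in_fiber alex_le_topspace[OF le] x by blast
    have 2: "\<beta> b' (C b b' x) \<in> fiber E p b'"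
      using in_fiber alex_le_topspace[OF le] aut_functor_in_topspace[OF C le x] by blast
    show ?thesis
      using canonical_rep_horizontal[OF F E le 1] 2
        horizontal_unique[OF F E, of "\<beta> b x" "\<beta> b' (C b b' x)" "arr (canonical_rep B F E p) b b' (\<beta> b x)"]
      by (auto simp: fiber_def)
  qed
  then show ?thesis
    \<comment> \<open>\<open>conj_cong\<close> makes the homeomorphism condition on
      \<open>\<beta>\<close> available while naturality is rewritten.\<close>
    unfolding top_naturally_isomorphic_def natural_family_def ob_canonical_rep
    by (simp add: aut_incl_def cong: conj_cong)
qed

text \<open>Transport is conjugated by homeomorphisms between the fibres and \<open>F\<close>. These
  are chosen fibre by fibre without any compatibility; the functor laws then follow from uniqueness
  of horizontal partners.\<close>

lemma canonical_rep_aut_functor: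
  assumes F: "t0_space F" and E: "fiber_bundle B F E p"
  shows "\<exists>C. aut_functor B F C \<and> top_naturally_isomorphic B (aut_incl F C) (canonical_rep B F E p)"
proof -
  let ?D = "arr (canonical_rep B F E p)"
  have "\<exists>k \<beta>. homeomorphic_maps (subtopology E (fiber E p b)) F k \<beta>" if b: "b \<in> topspace B" for b
    using fiber_bundle_trivialization[OF E b] trivialization_fiber b homeomorphic_map_maps by metis
  then obtain k \<beta> where k\<beta>: "\<And>b. b \<in> topspace B \<Longrightarrow> homeomorphic_maps (subtopology E (fiber E p b)) F (k b) (\<beta> b)"
    by metis
  define C where "C b b' = k b' \<circ> (?D b b' \<circ> \<beta> b)" for b b'
  have \<beta>: "homeomorphic_map F (subtopology E (fiber E p b)) (\<beta> b)"
    and k: "homeomorphic_map (subtopology E (fiber E p b)) F (k b)" if "b \<in> topspace B" for b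
    using k\<beta>[OF that] by (auto simp: homeomorphic_maps_map)
  have \<beta>_fiber: "\<beta> b x \<in> fiber E p b" if "b \<in> topspace B" "x \<in> topspace F" for b x
    using homeomorphic_map_in_topspace[OF \<beta>] that by (simp add: topspace_fiber)
  have \<beta>_inj: "x = y"
    if "b \<in> topspace B" "x \<in> topspace F" "y \<in> topspace F" "\<beta> b x = \<beta> b y" for b x y
    using homeomorphic_imp_injective_map[OF \<beta>[OF that(1)]] that by (simp add: inj_on_eq_iff)
  have C_homeo: "homeomorphic_map F F (C b b')" if le: "alex_le B b b'" for b b'
    unfolding C_def using alex_le_topspace[OF le]
    by (blast intro: homeomorphic_map_compose \<beta> k homeomorphic_map_canonical_rep[OF F E le])
  have CF: "C b b' x \<in> topspace F" if "alex_le B b b'" "x \<in> topspace F" for b b' x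
    using homeomorphic_map_in_topspace[OF C_homeo] that .
  have hor: "horizontal E p (\<beta> b x) (\<beta> b' (C b b' x))"
    if le: "alex_le B b b'" and x: "x \<in> topspace F" for b b' x
  proof -
    have bB: "b \<in> topspace B" "b' \<in> topspace B"
      using alex_le_topspace[OF le] by auto
    note D = canonical_rep_horizontal[OF F E le \<beta>_fiber[OF bB(1) x]]
    have "\<beta> b' (C b b' x) = ?D b b' (\<beta> b x)"
      using k\<beta>[OF bB(2)] D(1) unfolding C_def homeomorphic_maps_def topspace_fiber by simp
    then show ?thesis
      using D(2) by simp
  qed
  \<comment> \<open>Points of \<open>F\<close> are compared through \<open>\<beta> b\<close>: they
    agree once their images are horizontal partners of a common point.\<close>
  have eqI: "x = y" if "horizontal E p e (\<beta> b x)" "horizontal E p e (\<beta> b y)" "b \<in> topspace B"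
    "x \<in> topspace F" "y \<in> topspace F" for e b x y
    using horizontal_unique[OF F E that(1,2)] \<beta>_fiber that \<beta>_inj by (simp add: fiber_def)
  have C: "aut_functor B F C"
    unfolding aut_functor_def top_functor_def aut_incl_def top_diagram.simps
  proof (intro conjI allI impI ballI)
    show "homeomorphic_map F F (C b b')" if "alex_le B b b'" for b b'
      by (rule C_homeo[OF that])
    then show "continuous_map F F (C b b')" if "alex_le B b b'" for b b'
      using that homeomorphic_imp_continuous_map by blast
    show "C b b x = x" if b: "b \<in> topspace B" and x: "x \<in> topspace F" for b x
    proof (rule eqI)
      show "horizontal E p (\<beta> b x) (\<beta> b (C b b x))"
        by (rule hor[OF alex_le_refl[OF b] x])
      show "horizontal E p (\<beta> b x) (\<beta> b x)"
        using \<beta>_fiber[OF b x] by (simp add: fiber_def horizontal_refl)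
    qed (use b x CF[OF alex_le_refl[OF b] x] in auto)
    show "C b b'' x = C b' b'' (C b b' x)"
      if le: "alex_le B b b'" "alex_le B b' b''" and x: "x \<in> topspace F" for b b' b'' x
    proof (rule eqI)
      show "horizontal E p (\<beta> b x) (\<beta> b'' (C b b'' x))"
        by (rule hor[OF alex_le_trans[OF le] x])
      show "horizontal E p (\<beta> b x) (\<beta> b'' (C b' b'' (C b b' x)))"
        using horizontal_trans[OF F E hor[OF le(1) x] hor[OF le(2) CF[OF le(1) x]]] .
    qed (use le x CF alex_le_trans[OF le] alex_le_topspace[OF le(2)] in auto)
  qed
  moreover have "top_naturally_isomorphic B (aut_incl F C) (canonical_rep B F E p)"
    unfolding isomorphic_canonical_rep_iff[OF F E C] using \<beta> hor by blast
  ultimately show ?thesis by blast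
qed


section \<open>The Grothendieck construction\<close>

lemma mem_groth_basic:
  "b \<in> topspace B \<Longrightarrow>
     (v, x) \<in> groth_basic B D b V \<longleftrightarrow> alex_le B v b \<and> x \<in> topspace (ob D v) \<and> arr D v b x \<in> V"
  by (auto simp: groth_basic_def mem_min_nbhd_iff)

text \<open>Around \<open>(b, x)\<close> it is enough to test basic sets anchored at
  \<open>b\<close> itself, because one anchored at some \<open>c\<close> above \<open>b\<close> can
  be pulled back along the arrow from \<open>b\<close> to \<open>c\<close>.\<close>

lemma openin_groth:
  assumes D: "top_functor B D"
  shows "openin (groth B D) W \<longleftrightarrow>
    W \<subseteq> (SIGMA b:topspace B. topspace (ob D b)) \<and>
    (\<forall>b x. (b, x) \<in> W \<longrightarrow> (\<exists>V. openin (ob D b) V \<and> x \<in> V \<and> groth_basic B D b V \<subseteq> W))"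
    (is "_ \<longleftrightarrow> ?open W")
proof -
  have D_cont: "continuous_map (ob D b) (ob D b') (arr D b b')" if "alex_le B b b'" for b b'
    using D that by (simp add: top_functor_def)
  have D_id: "arr D b b x = x" if "b \<in> topspace B" "x \<in> topspace (ob D b)" for b x
    using D that by (simp add: top_functor_def)
  have D_comp: "arr D b b'' x = arr D b' b'' (arr D b b' x)"
    if "alex_le B b b'" "alex_le B b' b''" "x \<in> topspace (ob D b)" for b b' b'' x
    using D that unfolding top_functor_def by blast
  have basic_open: "?open (groth_basic B D c V)"
    if c: "c \<in> topspace B" and V: "openin (ob D c) V" for c V
  proof (intro conjI allI impI)
    show "groth_basic B D c V \<subseteq> (SIGMA b:topspace B. topspace (ob D b))"
      by (auto simp: mem_groth_basic[OF c] dest: alex_le_topspace)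
    fix b x assume "(b, x) \<in> groth_basic B D c V"
    then have b: "alex_le B b c" "x \<in> topspace (ob D b)" "arr D b c x \<in> V"
      by (auto simp: mem_groth_basic[OF c])
    have bB: "b \<in> topspace B"
      using alex_le_topspace[OF b(1)] by simp
    let ?V = "{y \<in> topspace (ob D b). arr D b c y \<in> V}"
    have "openin (ob D b) ?V"
      using D_cont[OF b(1)] V by (simp add: continuous_map_def)
    moreover have "groth_basic B D b ?V \<subseteq> groth_basic B D c V"
    proof clarify
      fix v y assume "(v, y) \<in> groth_basic B D b ?V"
      then have "alex_le B v b" "y \<in> topspace (ob D v)" "arr D b c (arr D v b y) \<in> V"
        by (auto simp: mem_groth_basic[OF bB])
      then show "(v, y) \<in> groth_basic B D c V"
        using D_comp[OF _ b(1)] alex_le_trans[OF _ b(1)] by (simp add: mem_groth_basic[OF c])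
    qed
    ultimately show "\<exists>V'. openin (ob D b) V' \<and> x \<in> V' \<and> groth_basic B D b V' \<subseteq> groth_basic B D c V"
      using b by blast
  qed
  have "(arbitrary union_of
       (\<lambda>W. \<exists>b\<in>topspace B. \<exists>V. openin (ob D b) V \<and> W = groth_basic B D b V)) W \<longleftrightarrow> ?open W" for W
    unfolding arbitrary_union_of_alt
  proof (intro iffI conjI subsetI ballI allI impI)
    fix z assume "\<forall>z\<in>W. \<exists>U. (\<exists>b\<in>topspace B. \<exists>V. openin (ob D b) V \<and> U = groth_basic B D b V) \<and> z \<in> U \<and> U \<subseteq> W"
      and "z \<in> W"
    then obtain c V where c: "c \<in> topspace B" "openin (ob D c) V" "z \<in> groth_basic B D c V"
      by blast
    then show "z \<in> (SIGMA b:topspace B. topspace (ob D b))"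
      using conjunct1[OF basic_open[OF c(1,2)]] by blast
  next
    fix b x assume "\<forall>z\<in>W. \<exists>U. (\<exists>b\<in>topspace B. \<exists>V. openin (ob D b) V \<and> U = groth_basic B D b V) \<and> z \<in> U \<and> U \<subseteq> W"
      and "(b, x) \<in> W"
    then obtain c V where c: "c \<in> topspace B" "openin (ob D c) V" "(b, x) \<in> groth_basic B D c V"
      "groth_basic B D c V \<subseteq> W"
      by blast
    then obtain V' where "openin (ob D b) V'" "x \<in> V'" "groth_basic B D b V' \<subseteq> groth_basic B D c V"
      using conjunct2[OF basic_open[OF c(1,2)]] by metis
    then show "\<exists>V. openin (ob D b) V \<and> x \<in> V \<and> groth_basic B D b V \<subseteq> W"
      using c(4) by blast
  next
    fix z assume W: "?open W" and z: "z \<in> W"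
    obtain b x where bx: "z = (b, x)" "b \<in> topspace B" "x \<in> topspace (ob D b)"
      using W z by blast
    then obtain V where "openin (ob D b) V" "x \<in> V" "groth_basic B D b V \<subseteq> W"
      using W z by blast
    moreover have "z \<in> groth_basic B D b V"
      using bx \<open>x \<in> V\<close> by (simp add: mem_groth_basic alex_le_refl D_id)
    ultimately show "\<exists>U. (\<exists>b\<in>topspace B. \<exists>V. openin (ob D b) V \<and> U = groth_basic B D b V) \<and> z \<in> U \<and> U \<subseteq> W"
      using bx(2) by blast
  qed
  then have groth: "groth B D = topology ?open"
    unfolding groth_def by presburger
  \<comment> \<open>Needed before \<open>openin\<close> can be computed: \<open>topology\<close>
    inverts \<open>openin\<close> only on predicates satisfying \<open>istopology\<close>.\<close>
  have "istopology ?open"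
    unfolding istopology_def
  proof (rule conjI; intro allI impI)
    fix S T assume S: "?open S" and T: "?open T"
    have "\<exists>V. openin (ob D b) V \<and> x \<in> V \<and> groth_basic B D b V \<subseteq> S \<inter> T" if "(b, x) \<in> S \<inter> T" for b x
    proof -
      obtain V V' where V: "openin (ob D b) V" "x \<in> V" "groth_basic B D b V \<subseteq> S"
        "openin (ob D b) V'" "x \<in> V'" "groth_basic B D b V' \<subseteq> T"
        using S T \<open>(b, x) \<in> S \<inter> T\<close> by (metis IntD1 IntD2)
      \<comment> \<open>Both sets are anchored at the same \<open>b\<close>, so intersecting the
        parameters suffices.\<close>
      then have "groth_basic B D b (V \<inter> V') \<subseteq> S \<inter> T"
        by (auto simp: groth_basic_def)
      then show ?thesis
        using V by (meson IntI openin_Int)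
    qed
    then show "?open (S \<inter> T)"
      using S by blast
  next
    fix \<K> assume \<K>: "\<forall>K\<in>\<K>. ?open K"
    show "?open (\<Union>\<K>)"
    proof (intro conjI allI impI)
      show "\<Union>\<K> \<subseteq> (SIGMA b:topspace B. topspace (ob D b))"
        using \<K> by (intro Union_least) simp
      fix b x assume "(b, x) \<in> \<Union>\<K>"
      then obtain K where K: "K \<in> \<K>" "(b, x) \<in> K"
        by blast
      then obtain V where "openin (ob D b) V" "x \<in> V" "groth_basic B D b V \<subseteq> K"
        using \<K> by meson
      then show "\<exists>V. openin (ob D b) V \<and> x \<in> V \<and> groth_basic B D b V \<subseteq> \<Union>\<K>"
        using K(1) by blast
    qed
  qed
  then show ?thesis
    by (simp add: groth)
qed

lemma topspace_groth:
  assumes "top_functor B D"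
  shows "topspace (groth B D) = (SIGMA b:topspace B. topspace (ob D b))"
proof
  show "topspace (groth B D) \<subseteq> (SIGMA b:topspace B. topspace (ob D b))"
    using openin_groth[OF assms, of "topspace (groth B D)"] by simp
  have "openin (groth B D) (SIGMA b:topspace B. topspace (ob D b))"
    unfolding openin_groth[OF assms]
    by (fastforce simp: mem_groth_basic dest: alex_le_topspace)
  then show "(SIGMA b:topspace B. topspace (ob D b)) \<subseteq> topspace (groth B D)"
    by (rule openin_subset)
qed

lemma continuous_map_groth_proj:
  assumes "top_functor B D"
  shows "continuous_map (groth B D) B groth_proj"
  unfolding continuous_map_def
proof (intro conjI allI impI)
  show "groth_proj \<in> topspace (groth B D) \<rightarrow> topspace B"
    by (auto simp: topspace_groth[OF assms] groth_proj_def)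
  fix U assume U: "openin B U"
  show "openin (groth B D) {z \<in> topspace (groth B D). groth_proj z \<in> U}"
    unfolding openin_groth[OF assms] topspace_groth[OF assms]
  proof (intro conjI allI impI)
    fix b x assume "(b, x) \<in> {z \<in> SIGMA b:topspace B. topspace (ob D b). groth_proj z \<in> U}"
    then have b: "b \<in> topspace B" "x \<in> topspace (ob D b)" "b \<in> U"
      by (auto simp: groth_proj_def)
    then have "groth_basic B D b (topspace (ob D b)) \<subseteq>
        {z \<in> SIGMA b:topspace B. topspace (ob D b). groth_proj z \<in> U}"
      using alex_le_open[OF _ U]
      by (auto simp: mem_groth_basic groth_proj_def dest: alex_le_topspace)
    with b(2) show "\<exists>V. openin (ob D b) V \<and> x \<in> V \<and>
        groth_basic B D b V \<subseteq> {z \<in> SIGMA b:topspace B. topspace (ob D b). groth_proj z \<in> U}"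
      by blast
  qed auto
qed


section \<open>Grothendieck constructions of functors to Aut(F) as fiber bundles\<close>

lemma aut_functor_top_functor: "aut_functor B F C \<Longrightarrow> top_functor B (aut_incl F C)"
  by (simp add: aut_functor_def)

lemma topspace_groth_aut:
  "aut_functor B F C \<Longrightarrow> topspace (groth B (aut_incl F C)) = topspace B \<times> topspace F"
  unfolding topspace_groth[OF aut_functor_top_functor] by (simp add: aut_incl_def)

text \<open>Every fibre over the minimal neighbourhood of \<open>b\<close> is carried
  homeomorphically to the fibre over \<open>b\<close> by \<open>C v b\<close>, which serves as the
  \<open>F\<close>-coordinate.\<close>

lemma groth_trivialization:
  assumes B: "alexandroff_space B" and C: "aut_functor B F C" and b: "b \<in> topspace B"
  shows "trivialization (groth B (aut_incl F C)) B F groth_proj (min_nbhd B b) (\<lambda>(v, x). (v, C v b x))"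
proof -
  let ?G = "groth B (aut_incl F C)" and ?N = "min_nbhd B b" and ?\<tau> = "\<lambda>(v, x). (v, C v b x)"
  let ?P = "{e \<in> topspace ?G. groth_proj e \<in> ?N}"
  have N: "openin B ?N" and NB: "?N \<subseteq> topspace B"
    using openin_min_nbhd[OF B b] openin_subset by auto
  have le: "alex_le B v b" if "v \<in> ?N" for v
    using that mem_min_nbhd_iff[OF b] by simp
  have P: "?P = ?N \<times> topspace F"
    using NB by (auto simp: topspace_groth_aut[OF C] groth_proj_def)
  have P_open: "openin ?G ?P"
    using continuous_map_groth_proj[OF aut_functor_top_functor[OF C]] N
    by (simp add: continuous_map_def)
  have openG: "openin ?G W \<longleftrightarrow> W \<subseteq> topspace B \<times> topspace F \<and>
      (\<forall>v x. (v, x) \<in> W \<longrightarrow> (\<exists>V. openin F V \<and> x \<in> V \<and>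
         (\<forall>w y. alex_le B w v \<longrightarrow> y \<in> topspace F \<longrightarrow> C w v y \<in> V \<longrightarrow> (w, y) \<in> W)))" for W
  proof -
    have basic: "groth_basic B (aut_incl F C) v V \<subseteq> W \<longleftrightarrow>
        (\<forall>w y. alex_le B w v \<longrightarrow> y \<in> topspace F \<longrightarrow> C w v y \<in> V \<longrightarrow> (w, y) \<in> W)"
      if "v \<in> topspace B" for v V
      by (auto simp: mem_groth_basic[OF that] aut_incl_def)
    show ?thesis
      unfolding openin_groth[OF aut_functor_top_functor[OF C]]
    proof (intro conj_cong arg_cong[where f = All] ext imp_cong refl)
      show "W \<subseteq> (SIGMA b:topspace B. topspace (ob (aut_incl F C) b)) \<longleftrightarrow> W \<subseteq> topspace B \<times> topspace F"
        by (simp add: aut_incl_def)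
      fix v x assume "W \<subseteq> topspace B \<times> topspace F" and "(v, x) \<in> W"
      then have "v \<in> topspace B"
        by blast
      then show "(\<exists>V. openin (ob (aut_incl F C) v) V \<and> x \<in> V \<and> groth_basic B (aut_incl F C) v V \<subseteq> W) \<longleftrightarrow>
          (\<exists>V. openin F V \<and> x \<in> V \<and>
             (\<forall>w y. alex_le B w v \<longrightarrow> y \<in> topspace F \<longrightarrow> C w v y \<in> V \<longrightarrow> (w, y) \<in> W))"
        by (simp add: basic) (simp add: aut_incl_def)
    qed
  qed
  have "homeomorphic_map (subtopology ?G ?P) (prod_topology (subtopology B ?N) F) ?\<tau>"
  proof (rule bijective_open_imp_homeomorphic_map)
    have top: "topspace (subtopology ?G ?P) = ?N \<times> topspace F"
      using P by auto
    have top': "topspace (prod_topology (subtopology B ?N) F) = ?N \<times> topspace F"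
      using NB by auto
    show "continuous_map (subtopology ?G ?P) (prod_topology (subtopology B ?N) F) ?\<tau>"
      unfolding continuous_map_def top top'
    proof (intro conjI allI impI)
      show "?\<tau> \<in> ?N \<times> topspace F \<rightarrow> ?N \<times> topspace F"
        using le aut_functor_in_topspace[OF C] by auto
      fix W assume W: "openin (prod_topology (subtopology B ?N) F) W"
      have "openin ?G {z \<in> ?N \<times> topspace F. ?\<tau> z \<in> W}"
        unfolding openG
      proof (intro conjI allI impI)
        show "{z \<in> ?N \<times> topspace F. ?\<tau> z \<in> W} \<subseteq> topspace B \<times> topspace F"
          using NB by auto
        fix v x assume "(v, x) \<in> {z \<in> ?N \<times> topspace F. ?\<tau> z \<in> W}"
        then have v: "v \<in> ?N" "x \<in> topspace F" "(v, C v b x) \<in> W"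
          by auto
        then obtain S V where SV: "openin (subtopology B ?N) S" "openin F V" "v \<in> S" "C v b x \<in> V"
          "S \<times> V \<subseteq> W"
          using W v(3) unfolding openin_prod_topology_alt by meson
        have S: "openin B S" "S \<subseteq> ?N"
          using SV(1) N by (auto simp: openin_open_subtopology)
        \<comment> \<open>The preimage of \<open>V\<close> under \<open>C v b\<close>. For
          \<open>w\<close> below \<open>v\<close>, composition turns \<open>C v b (C w v y)\<close>
          into \<open>C w b y\<close>, and \<open>w\<close> stays in \<open>S\<close> because open
          sets are lower sets.\<close>
        let ?V = "{y \<in> topspace F. C v b y \<in> V}"
        have "openin F ?V"
          using homeomorphic_imp_continuous_map[OF aut_functor_homeomorphic[OF C le[OF v(1)]]] SV(2)
          by (simp add: continuous_map_def)
        moreover have "(w, y) \<in> {z \<in> ?N \<times> topspace F. ?\<tau> z \<in> W}"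
          if w: "alex_le B w v" "y \<in> topspace F" "C w v y \<in> ?V" for w y
        proof -
          have "w \<in> S"
            using alex_le_open[OF w(1) S(1) SV(3)] .
          moreover have "C w b y \<in> V"
            using w(3) aut_functor_comp[OF C w(1) le[OF v(1)] w(2)] by simp
          ultimately show ?thesis
            using S(2) SV(5) w(2) by auto
        qed
        ultimately show "\<exists>V. openin F V \<and> x \<in> V \<and>
          (\<forall>w y. alex_le B w v \<longrightarrow> y \<in> topspace F \<longrightarrow> C w v y \<in> V \<longrightarrow>
             (w, y) \<in> {z \<in> ?N \<times> topspace F. ?\<tau> z \<in> W})"
          using v SV(4) by (intro exI[of _ ?V]) simp
      qed
      then show "openin (subtopology ?G ?P) {z \<in> ?N \<times> topspace F. ?\<tau> z \<in> W}"
        using P_open P by (auto simp: openin_open_subtopology)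
    qed
    show "open_map (subtopology ?G ?P) (prod_topology (subtopology B ?N) F) ?\<tau>"
      unfolding open_map_def
    proof (intro allI impI)
      fix W assume "openin (subtopology ?G ?P) W"
      then have W: "openin ?G W" and WP: "W \<subseteq> ?N \<times> topspace F"
        using P_open P by (auto simp: openin_open_subtopology)
      show "openin (prod_topology (subtopology B ?N) F) (?\<tau> ` W)"
        unfolding openin_prod_topology_alt
      proof (intro allI impI)
        fix v z assume "(v, z) \<in> ?\<tau> ` W"
        then obtain x where x: "(v, x) \<in> W" "z = C v b x"
          by auto
        then have v: "v \<in> ?N" "x \<in> topspace F"
          using WP by auto
        then have vB: "v \<in> topspace B"
          using NB by blast
        obtain V where V: "openin F V" "x \<in> V"
          "\<And>w y. alex_le B w v \<Longrightarrow> y \<in> topspace F \<Longrightarrow> C w v y \<in> V \<Longrightarrow> (w, y) \<in> W"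
          using W x(1) unfolding openG by blast
        \<comment> \<open>The box around \<open>(v, z)\<close> is the minimal neighbourhood of
          \<open>v\<close> times the image of \<open>V\<close> under \<open>C v b\<close>.\<close>
        have "openin (subtopology B ?N) (min_nbhd B v)"
          using openin_min_nbhd[OF B vB] min_nbhd_subset[OF N v(1)] N
          by (simp add: openin_open_subtopology)
        moreover have "openin F (C v b ` V)"
          using homeomorphic_imp_open_map[OF aut_functor_homeomorphic[OF C le[OF v(1)]]] V(1)
          by (simp add: open_map_def)
        moreover have "(w, u) \<in> ?\<tau> ` W" if w: "w \<in> min_nbhd B v" and u: "u \<in> C v b ` V" for w u
        proof -
          have wv: "alex_le B w v"
            using w mem_min_nbhd_iff[OF vB] by simp
          obtain t where t: "t \<in> V" "u = C v b t"
            using u by blast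
          \<comment> \<open>Surjectivity of \<open>C w v\<close> enters here: \<open>t\<close> over
            \<open>v\<close> is pulled back to some \<open>y\<close> over \<open>w\<close>, and the
            openness criterion puts \<open>(w, y)\<close> into \<open>W\<close>.\<close>
          then have "t \<in> C w v ` topspace F"
            using homeomorphic_imp_surjective_map[OF aut_functor_homeomorphic[OF C wv]]
              openin_subset[OF V(1)] by blast
          then obtain y where y: "y \<in> topspace F" "t = C w v y"
            by blast
          then have "(w, y) \<in> W" "u = C w b y"
            using V(3)[OF wv] t aut_functor_comp[OF C wv le[OF v(1)]] by auto
          then show ?thesis by force
        qed
        ultimately show "\<exists>S V. openin (subtopology B ?N) S \<and> openin F V \<and> v \<in> S \<and> z \<in> V \<and> S \<times> V \<subseteq> ?\<tau> ` W"
          using x V(2) mem_min_nbhd_self[of v B]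
          by (intro exI[of _ "min_nbhd B v"] exI[of _ "C v b ` V"] conjI subsetI) (auto simp del: image_iff)
      qed
    qed
    have surj: "C v b ` topspace F = topspace F" and inj: "inj_on (C v b) (topspace F)"
      if "v \<in> ?N" for v
      using aut_functor_homeomorphic[OF C le[OF that]] homeomorphic_imp_surjective_map
        homeomorphic_imp_injective_map by blast+
    show "?\<tau> ` topspace (subtopology ?G ?P) = topspace (prod_topology (subtopology B ?N) F)"
      unfolding top top'
    proof
      show "?\<tau> ` (?N \<times> topspace F) \<subseteq> ?N \<times> topspace F"
        using le aut_functor_in_topspace[OF C] by auto
      show "?N \<times> topspace F \<subseteq> ?\<tau> ` (?N \<times> topspace F)"
      proof clarify
        fix v z assume v: "v \<in> ?N" "z \<in> topspace F"
        then obtain x where "x \<in> topspace F" "z = C v b x"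
          using surj[OF v(1)] by blast
        then show "(v, z) \<in> ?\<tau> ` (?N \<times> topspace F)"
          using v by force
      qed
    qed
    show "inj_on ?\<tau> (topspace (subtopology ?G ?P))"
      unfolding top using inj by (auto simp: inj_on_def)
  qed
  then show ?thesis
    by (auto simp: trivialization_def groth_proj_def)
qed

lemma fiber_bundle_groth:
  assumes B: "alexandroff_space B" and C: "aut_functor B F C"
  shows "fiber_bundle B F (groth B (aut_incl F C)) groth_proj"
  unfolding fiber_bundle_def
  using continuous_map_groth_proj[OF aut_functor_top_functor[OF C]] groth_trivialization[OF B C]
    openin_min_nbhd[OF B] mem_min_nbhd_self by metis

text \<open>In the chart over the minimal neighbourhood of \<open>b'\<close>, the first point has
  coordinate \<open>C b b' x\<close> and the second \<open>C b' b' (C b b' x)\<close>; the identity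
  law makes them equal.\<close>

lemma horizontal_groth:
  assumes B: "alexandroff_space B" and F: "t0_space F" and C: "aut_functor B F C"
    and le: "alex_le B b b'" and x: "x \<in> topspace F"
  shows "horizontal (groth B (aut_incl F C)) groth_proj (b, x) (b', C b b' x)"
proof -
  have bB: "b \<in> topspace B" "b' \<in> topspace B"
    using alex_le_topspace[OF le] by auto
  have Cx: "C b b' x \<in> topspace F"
    by (rule aut_functor_in_topspace[OF C le x])
  show ?thesis
    using horizontal_iff[OF F openin_min_nbhd[OF B bB(2)] groth_trivialization[OF B C bB(2)],
        of "(b, x)" "(b', C b b' x)"] bB x Cx le mem_min_nbhd_self[of b' B] aut_functor_id[OF C bB(2) Cx]
    by (simp add: topspace_groth_aut[OF C] groth_proj_def)
qed

text \<open>The chart centred at \<open>b\<close> acts on the fibre over \<open>b\<close> by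
  \<open>C b b\<close>, the identity, so its inverse there is \<open>Pair b\<close>.\<close>

lemma homeomorphic_map_groth_fiber:
  assumes B: "alexandroff_space B" and C: "aut_functor B F C" and b: "b \<in> topspace B"
  shows "homeomorphic_map F (subtopology (groth B (aut_incl F C))
           (fiber (groth B (aut_incl F C)) groth_proj b)) (Pair b)"
proof -
  let ?G = "groth B (aut_incl F C)"
  obtain g where g: "homeomorphic_maps (subtopology ?G (fiber ?G groth_proj b)) F
      (snd \<circ> (\<lambda>(v, x). (v, C v b x))) g"
    using trivialization_fiber[OF groth_trivialization[OF B C b] mem_min_nbhd_self b]
    by (auto simp: homeomorphic_map_maps)
  then have "homeomorphic_map F (subtopology ?G (fiber ?G groth_proj b)) g"
    by (simp add: homeomorphic_maps_map)
  then show ?thesis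
  proof (rule homeomorphic_map_eq)
    fix x assume x: "x \<in> topspace F"
    have "(b, x) \<in> topspace (subtopology ?G (fiber ?G groth_proj b))"
      using b x by (simp add: fiber_def topspace_groth_aut[OF C] groth_proj_def)
    then have "g ((snd \<circ> (\<lambda>(v, x). (v, C v b x))) (b, x)) = (b, x)"
      using g unfolding homeomorphic_maps_def by blast
    then show "g x = (b, x)"
      using aut_functor_id[OF C b x] by simp
  qed
qed

text \<open>This trades natural isomorphism with the canonical representation for bundle
  isomorphism, which is also defined between total spaces of different types.\<close>

lemma isomorphic_canonical_rep_iff_groth:
  assumes B: "alexandroff_space B" and F: "t0_space F"
    and C: "aut_functor B F C" and E: "fiber_bundle B F E p"
  shows "top_naturally_isomorphic B (aut_incl F C) (canonical_rep B F E p) \<longleftrightarrow>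
    bundle_isomorphic (groth B (aut_incl F C)) groth_proj E p"
    (is "_ \<longleftrightarrow> bundle_isomorphic ?G _ _ _")
proof
  assume "bundle_isomorphic ?G groth_proj E p"
  then obtain \<alpha> where \<alpha>: "homeomorphic_map ?G E \<alpha>" "\<And>e. e \<in> topspace ?G \<Longrightarrow> p (\<alpha> e) = groth_proj e"
    by (auto simp: bundle_isomorphic_def)
  have "homeomorphic_map F (subtopology E (fiber E p b)) (\<alpha> \<circ> Pair b)"
    if b: "b \<in> topspace B" for b
  proof (rule homeomorphic_map_compose[OF homeomorphic_map_groth_fiber[OF B C b]])
    show "homeomorphic_map (subtopology ?G (fiber ?G groth_proj b)) (subtopology E (fiber E p b)) \<alpha>"
      using \<alpha>(2) by (intro homeomorphic_map_subtopologies_alt[OF \<alpha>(1)]) (auto simp: fiber_def)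
  qed
  moreover have "horizontal E p ((\<alpha> \<circ> Pair b) x) ((\<alpha> \<circ> Pair b') (C b b' x))"
    if "alex_le B b b'" "x \<in> topspace F" for b b' x
    using horizontal_bundle_iso[OF \<alpha> horizontal_groth[OF B F C that]] by simp
  ultimately show "top_naturally_isomorphic B (aut_incl F C) (canonical_rep B F E p)"
    unfolding isomorphic_canonical_rep_iff[OF F E C] by (intro exI[of _ "\<lambda>b. \<alpha> \<circ> Pair b"]) blast
next
  assume "top_naturally_isomorphic B (aut_incl F C) (canonical_rep B F E p)"
  then obtain \<beta> where \<beta>: "\<And>b. b \<in> topspace B \<Longrightarrow> homeomorphic_map F (subtopology E (fiber E p b)) (\<beta> b)"
    and hor: "\<And>b b' x. alex_le B b b' \<Longrightarrow> x \<in> topspace F \<Longrightarrow> horizontal E p (\<beta> b x) (\<beta> b' (C b b' x))"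
    unfolding isomorphic_canonical_rep_iff[OF F E C] by blast
  define \<gamma> where "\<gamma> = (\<lambda>(b, x). \<beta> b x)"
  have \<beta>_fiber: "\<beta> b x \<in> topspace E" "p (\<beta> b x) = b" if "b \<in> topspace B" "x \<in> topspace F" for b x
    using homeomorphic_map_in_topspace[OF \<beta>] that by (auto simp: fiber_def)
  have over: "p (\<gamma> e) = groth_proj e" if "e \<in> topspace ?G" for e
    using that \<beta>_fiber by (auto simp: topspace_groth_aut[OF C] \<gamma>_def groth_proj_def)
  have "homeomorphic_map ?G E \<gamma>"
  proof (rule homeomorphic_map_locally_over)
    show "continuous_map ?G B groth_proj" "continuous_map E B p"
      using fiber_bundle_groth[OF B C] E fiber_bundle_continuous by blast+
    fix b assume b: "b \<in> topspace B"
    let ?N = "min_nbhd B b" and ?\<tau> = "\<lambda>(v, x). (v, C v b x)"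
    have N: "openin B ?N"
      by (rule openin_min_nbhd[OF B b])
    obtain U \<phi> where U: "openin B U" "b \<in> U" "trivialization E B F p U \<phi>"
      using fiber_bundle_trivialization[OF E b] .
    have \<phi>: "trivialization E B F p ?N \<phi>"
      by (rule trivialization_subset[OF U(3) min_nbhd_subset[OF U(1,2)]])
    obtain \<psi> where \<psi>: "homeomorphic_maps (subtopology E {e \<in> topspace E. p e \<in> ?N})
        (prod_topology (subtopology B ?N) F) \<phi> \<psi>"
      using \<phi> by (auto simp: trivialization_def homeomorphic_map_maps)
    \<comment> \<open>\<open>g\<close> is \<open>\<beta> b\<close> read in the chart
      \<open>\<phi>\<close>, a self-homeomorphism of \<open>F\<close> attached to the single point
      \<open>b\<close>.\<close>
    define g where "g = (snd \<circ> \<phi>) \<circ> \<beta> b"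
    have "homeomorphic_map F F g"
      unfolding g_def
      by (rule homeomorphic_map_compose[OF \<beta>[OF b] trivialization_fiber[OF \<phi> mem_min_nbhd_self b]])
    then obtain g' where "homeomorphic_maps F F g g'"
      by (auto simp: homeomorphic_map_maps)
    then have "homeomorphic_maps (prod_topology (subtopology B ?N) F) (prod_topology (subtopology B ?N) F)
        (\<lambda>(v, x). (id v, g x)) (\<lambda>(v, x). (id v, g' x))"
      by (simp only: homeomorphic_maps_prod homeomorphic_maps_id) simp
    then have h: "homeomorphic_map (prod_topology (subtopology B ?N) F) (prod_topology (subtopology B ?N) F)
        (\<lambda>(v, x). (v, g x))"
      by (simp add: homeomorphic_maps_map)
    have \<tau>: "homeomorphic_map (subtopology ?G {e \<in> topspace ?G. groth_proj e \<in> ?N})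
        (prod_topology (subtopology B ?N) F) ?\<tau>"
      using groth_trivialization[OF B C b] by (simp add: trivialization_def)
    have "homeomorphic_map (subtopology ?G {e \<in> topspace ?G. groth_proj e \<in> ?N})
        (subtopology E {e \<in> topspace E. p e \<in> ?N}) (\<psi> \<circ> ((\<lambda>(v, x). (v, g x)) \<circ> ?\<tau>))"
      using homeomorphic_map_compose[OF homeomorphic_map_compose[OF \<tau> h]] \<psi>
      unfolding homeomorphic_maps_map by blast
    then have "homeomorphic_map (subtopology ?G {e \<in> topspace ?G. groth_proj e \<in> ?N})
        (subtopology E {e \<in> topspace E. p e \<in> ?N}) \<gamma>"
    proof (rule homeomorphic_map_eq)
      fix z assume "z \<in> topspace (subtopology ?G {e \<in> topspace ?G. groth_proj e \<in> ?N})"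
      then obtain v x where z: "z = (v, x)" "v \<in> topspace B" "x \<in> topspace F" "v \<in> ?N"
        by (auto simp: topspace_groth_aut[OF C] groth_proj_def)
      have le: "alex_le B v b"
        using z(4) mem_min_nbhd_iff[OF b] by simp
      have Cx: "C v b x \<in> topspace F"
        by (rule aut_functor_in_topspace[OF C le z(3)])
      \<comment> \<open>Along a horizontal pair \<open>\<phi>\<close> keeps the
        \<open>F\<close>-coordinate, so the same \<open>g\<close> describes \<open>\<gamma>\<close>
        over every \<open>v\<close> in the neighbourhood.\<close>
      have "snd (\<phi> (\<beta> v x)) = snd (\<phi> (\<beta> b (C v b x)))"
        using horizontal_iff[OF F N \<phi>, of "\<beta> v x" "\<beta> b (C v b x)"] hor[OF le z(3)]
          \<beta>_fiber[OF z(2,3)] \<beta>_fiber[OF b Cx] le mem_min_nbhd_self[of b B] by simp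
      moreover have "fst (\<phi> (\<beta> v x)) = v"
        using \<phi> \<beta>_fiber[OF z(2,3)] z(4) by (simp add: trivialization_def)
      ultimately have "(v, g (C v b x)) = \<phi> (\<beta> v x)"
        by (simp add: g_def prod_eq_iff)
      moreover have "\<psi> (\<phi> (\<beta> v x)) = \<beta> v x"
        using \<psi> \<beta>_fiber[OF z(2,3)] z(4) by (simp add: homeomorphic_maps_def)
      ultimately show "(\<psi> \<circ> ((\<lambda>(v, x). (v, g x)) \<circ> ?\<tau>)) z = \<gamma> z"
        by (simp add: z(1) \<gamma>_def)
    qed
    then show "\<exists>U. openin B U \<and> b \<in> U \<and>
      homeomorphic_map (subtopology ?G {x \<in> topspace ?G. groth_proj x \<in> U})
        (subtopology E {y \<in> topspace E. p y \<in> U}) \<gamma>"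
      using N mem_min_nbhd_self[of b B] by (intro exI[of _ ?N]) simp
  qed (rule over)
  with over show "bundle_isomorphic ?G groth_proj E p"
    by (auto simp: bundle_isomorphic_def)
qed


section \<open>The bijection\<close>

lemma top_naturally_isomorphic_trans:
  assumes "top_naturally_isomorphic B D D'" and "top_naturally_isomorphic B D' D''"
  shows "top_naturally_isomorphic B D D''"
proof -
  obtain \<alpha> \<beta> where \<alpha>: "\<forall>b\<in>topspace B. homeomorphic_map (ob D b) (ob D' b) (\<alpha> b)" "natural_family B D D' \<alpha>"
    and \<beta>: "\<forall>b\<in>topspace B. homeomorphic_map (ob D' b) (ob D'' b) (\<beta> b)" "natural_family B D' D'' \<beta>"
    using assms by (auto simp: top_naturally_isomorphic_def)
  have "\<alpha> b x \<in> topspace (ob D' b)" if "alex_le B b b'" "x \<in> topspace (ob D b)" for b b' x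
    using \<alpha>(1) that homeomorphic_map_in_topspace alex_le_topspace by metis
  then have "natural_family B D D'' (\<lambda>b. \<beta> b \<circ> \<alpha> b)"
    using \<alpha>(2) \<beta>(2) by (simp add: natural_family_def)
  with \<alpha>(1) \<beta>(1) show ?thesis
    unfolding top_naturally_isomorphic_def
    by (intro exI[of _ "\<lambda>b. \<beta> b \<circ> \<alpha> b"]) (auto intro: homeomorphic_map_compose)
qed

text \<open>Functoriality of \<open>D\<close> keeps \<open>arr D b b' (\<beta> b y)\<close> inside
  the carrier over \<open>b'\<close>, where \<open>\<beta> b'\<close> cancels
  \<open>\<alpha> b'\<close>.\<close>

lemma top_naturally_isomorphic_sym:
  assumes D: "top_functor B D" and "top_naturally_isomorphic B D D'"
  shows "top_naturally_isomorphic B D' D"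
proof -
  obtain \<alpha> where \<alpha>: "\<And>b. b \<in> topspace B \<Longrightarrow> homeomorphic_map (ob D b) (ob D' b) (\<alpha> b)"
    and nat: "natural_family B D D' \<alpha>"
    using assms by (auto simp: top_naturally_isomorphic_def)
  obtain \<beta> where \<beta>: "\<And>b. b \<in> topspace B \<Longrightarrow> homeomorphic_maps (ob D b) (ob D' b) (\<alpha> b) (\<beta> b)"
    using \<alpha> unfolding homeomorphic_map_maps by metis
  have "\<beta> b' (arr D' b b' y) = arr D b b' (\<beta> b y)"
    if le: "alex_le B b b'" and y: "y \<in> topspace (ob D' b)" for b b' y
  proof -
    have b: "b \<in> topspace B" "b' \<in> topspace B"
      using alex_le_topspace[OF le] by auto
    have x: "\<beta> b y \<in> topspace (ob D b)" "\<alpha> b (\<beta> b y) = y"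
      using \<beta>[OF b(1)] y by (auto simp: homeomorphic_maps_def continuous_map_def)
    have "arr D b b' (\<beta> b y) \<in> topspace (ob D b')"
      using D le x(1) by (auto simp: top_functor_def continuous_map_def)
    then have "\<beta> b' (\<alpha> b' (arr D b b' (\<beta> b y))) = arr D b b' (\<beta> b y)"
      using \<beta>[OF b(2)] by (simp add: homeomorphic_maps_def)
    then show ?thesis
      using nat le x by (simp add: natural_family_def)
  qed
  then show ?thesis
    unfolding top_naturally_isomorphic_def natural_family_def
    using \<beta> by (intro exI[of _ \<beta>]) (auto simp: homeomorphic_maps_map)
qed

lemma aut_naturally_isomorphic_iff:
  "aut_naturally_isomorphic B F C C' \<longleftrightarrow>
     top_naturally_isomorphic B (aut_incl F C) (aut_incl F C')"
  unfolding aut_naturally_isomorphic_def top_naturally_isomorphic_def by (simp add: aut_incl_def)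

lemma ex_bundle_isomorphic_copy:
  fixes i :: "'d \<Rightarrow> 'e"
  assumes "inj_on i (topspace E)"
  shows "\<exists>(E' :: 'e topology) q. bundle_isomorphic E p E' q"
  using homeomorphic_map_pullback_topology[OF assms] assms
  by (intro exI[of _ "pullback_topology (i ` topspace E) (inv_into (topspace E) i) E"]
      exI[of _ "p \<circ> inv_into (topspace E) i"])
     (auto simp: bundle_isomorphic_def)

text \<open>The injection \<open>i\<close> makes room in \<open>'e\<close> for a copy of every
  Grothendieck construction over \<open>B\<close> with fibre \<open>F\<close>, so that each functor
  class has a partner among the bundle classes.\<close>

theorem theorem4p12:
  fixes B :: "'b topology" and F :: "'f topology" and i :: "'b \<times> 'f \<Rightarrow> 'e"
  assumes "alexandroff_space B"
    and "t0_space F"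
    and "inj_on i (topspace B \<times> topspace F)"
  shows "\<exists>(\<Phi> :: ('e topology \<times> ('e \<Rightarrow> 'b)) set \<Rightarrow> ('b \<Rightarrow> 'b \<Rightarrow> 'f \<Rightarrow> 'f) set) \<Psi>.
           bij_betw \<Phi> (bundle_classes B F) (functor_classes B F) \<and>
           bij_betw \<Psi> (functor_classes B F) (bundle_classes B F) \<and>
           (\<forall>X\<in>bundle_classes B F. \<Psi> (\<Phi> X) = X) \<and>
           (\<forall>Y\<in>functor_classes B F. \<Phi> (\<Psi> Y) = Y) \<and>
           (\<forall>(E :: 'e topology) p. fiber_bundle B F E p \<longrightarrow>
              (\<exists>C. aut_functor B F C \<and>
                   top_naturally_isomorphic B (aut_incl F C) (canonical_rep B F E p)) \<and>
              (\<forall>C. aut_functor B F C \<and>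
                   top_naturally_isomorphic B (aut_incl F C) (canonical_rep B F E p) \<longrightarrow>
                   \<Phi> (bundle_class B F E p) = functor_class B F C)) \<and>
           (\<forall>C. aut_functor B F C \<longrightarrow>
              fiber_bundle B F (groth B (aut_incl F C)) groth_proj \<and>
              \<Psi> (functor_class B F C) = bundle_class B F (groth B (aut_incl F C)) groth_proj)"
proof -
  note B = assms(1) and F = assms(2)
  let ?G = "\<lambda>C. groth B (aut_incl F C)"
  \<comment> \<open>Both maps collect everything related to some member of the given class, so no
    representatives are chosen and well-definedness becomes \<open>\<Phi>_eq\<close> and
    \<open>\<Psi>_eq\<close> below.\<close>
  define \<Phi> :: "('e topology \<times> ('e \<Rightarrow> 'b)) set \<Rightarrow> ('b \<Rightarrow> 'b \<Rightarrow> 'f \<Rightarrow> 'f) set" where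
    "\<Phi> X = {C. aut_functor B F C \<and> (\<exists>(E, p)\<in>X. bundle_isomorphic (?G C) groth_proj E p)}" for X
  define \<Psi> :: "('b \<Rightarrow> 'b \<Rightarrow> 'f \<Rightarrow> 'f) set \<Rightarrow> ('e topology \<times> ('e \<Rightarrow> 'b)) set" where
    "\<Psi> Y = {(E, p). fiber_bundle B F E p \<and> (\<exists>C\<in>Y. bundle_isomorphic (?G C) groth_proj E p)}" for Y
  \<comment> \<open>Given that \<open>C\<close> realizes \<open>p\<close>, the functor
    \<open>C'\<close> realizes \<open>p\<close> exactly when it is isomorphic to \<open>C\<close>:
    both are compared with the canonical representation of \<open>p\<close>.\<close>
  have iso_iff: "aut_naturally_isomorphic B F C C' \<longleftrightarrow> bundle_isomorphic (?G C') groth_proj E p"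
    if C: "aut_functor B F C" and C': "aut_functor B F C'" and E: "fiber_bundle B F E p"
      and iso: "bundle_isomorphic (?G C) groth_proj E p" for C C' and E :: "'e topology" and p
  proof -
    have D: "top_naturally_isomorphic B (aut_incl F C) (canonical_rep B F E p)"
      using isomorphic_canonical_rep_iff_groth[OF B F C E] iso by simp
    show ?thesis
      unfolding aut_naturally_isomorphic_iff isomorphic_canonical_rep_iff_groth[OF B F C' E, symmetric]
    proof
      assume "top_naturally_isomorphic B (aut_incl F C) (aut_incl F C')"
      from top_naturally_isomorphic_sym[OF aut_functor_top_functor[OF C] this] D
      show "top_naturally_isomorphic B (aut_incl F C') (canonical_rep B F E p)"
        by (rule top_naturally_isomorphic_trans)
    next
      assume "top_naturally_isomorphic B (aut_incl F C') (canonical_rep B F E p)"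
      from D top_naturally_isomorphic_sym[OF aut_functor_top_functor[OF C'] this]
      show "top_naturally_isomorphic B (aut_incl F C) (aut_incl F C')"
        by (rule top_naturally_isomorphic_trans)
    qed
  qed
  have bundle_refl: "bundle_isomorphic E p E p" if "bundle_isomorphic X q E p"
    for X :: "('b \<times> 'f) topology" and q and E :: "'e topology" and p
    by (rule bundle_isomorphic_trans[OF bundle_isomorphic_sym[OF that] that])
  \<comment> \<open>If \<open>C\<close> and \<open>p\<close> are related, \<open>\<Phi>\<close> and
    \<open>\<Psi>\<close> interchange their classes. With a partner for every functor
    (\<open>ex_E\<close>) and for every bundle (\<open>ex_C\<close>), the maps are mutually
    inverse.\<close>
  have \<Phi>_eq: "\<Phi> (bundle_class B F E p) = functor_class B F C"
    if C: "aut_functor B F C" and E: "fiber_bundle B F E p"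
      and iso: "bundle_isomorphic (?G C) groth_proj E p" for C and E :: "'e topology" and p
  proof -
    have "(\<exists>(E' :: 'e topology, q)\<in>bundle_class B F E p. bundle_isomorphic (?G C') groth_proj E' q) \<longleftrightarrow>
        bundle_isomorphic (?G C') groth_proj E p" for C'
    proof
      assume "\<exists>(E' :: 'e topology, q)\<in>bundle_class B F E p. bundle_isomorphic (?G C') groth_proj E' q"
      then obtain E' :: "'e topology" and q where "bundle_isomorphic E p E' q"
        and "bundle_isomorphic (?G C') groth_proj E' q"
        by (auto simp: bundle_class_def)
      then show "bundle_isomorphic (?G C') groth_proj E p"
        using bundle_isomorphic_trans[OF _ bundle_isomorphic_sym] by blast
    next
      assume "bundle_isomorphic (?G C') groth_proj E p"
      then show "\<exists>(E' :: 'e topology, q)\<in>bundle_class B F E p. bundle_isomorphic (?G C') groth_proj E' q"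
        using E bundle_refl[OF iso] by (auto simp: bundle_class_def)
    qed
    then show ?thesis
      using iso_iff[OF C _ E iso] by (auto simp: \<Phi>_def functor_class_def)
  qed
  have \<Psi>_eq: "\<Psi> (functor_class B F C) = bundle_class B F E p"
    if C: "aut_functor B F C" and E: "fiber_bundle B F E p"
      and iso: "bundle_isomorphic (?G C) groth_proj E p" for C and E :: "'e topology" and p
  proof -
    have "(\<exists>C'\<in>functor_class B F C. bundle_isomorphic (?G C') groth_proj E' q) \<longleftrightarrow>
        bundle_isomorphic E p E' q" for E' :: "'e topology" and q
    proof
      assume "\<exists>C'\<in>functor_class B F C. bundle_isomorphic (?G C') groth_proj E' q"
      then obtain C' where C': "bundle_isomorphic (?G C') groth_proj E p"
        "bundle_isomorphic (?G C') groth_proj E' q"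
        using iso_iff[OF C _ E iso] by (auto simp: functor_class_def)
      show "bundle_isomorphic E p E' q"
        by (rule bundle_isomorphic_trans[OF bundle_isomorphic_sym[OF C'(1)] C'(2)])
    next
      assume "bundle_isomorphic E p E' q"
      then have "bundle_isomorphic (?G C) groth_proj E' q"
        using bundle_isomorphic_trans[OF iso] by blast
      moreover have "C \<in> functor_class B F C"
        using iso_iff[OF C C E iso] iso C by (simp add: functor_class_def)
      ultimately show "\<exists>C'\<in>functor_class B F C. bundle_isomorphic (?G C') groth_proj E' q"
        by blast
    qed
    then show ?thesis
      by (auto simp: \<Psi>_def bundle_class_def)
  qed
  \<comment> \<open>The Grothendieck construction has its points in another type than
    \<open>E\<close>, yet both determine the same class of bundles over \<open>'e\<close>.\<close>
  have class_eq: "(bundle_class B F (?G C) groth_proj :: ('e topology \<times> ('e \<Rightarrow> 'b)) set) = bundle_class B F E p"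
    if iso: "bundle_isomorphic (?G C) groth_proj E p" for C and E :: "'e topology" and p
  proof -
    have "bundle_isomorphic (?G C) groth_proj E' q \<longleftrightarrow> bundle_isomorphic E p E' q"
      for E' :: "'e topology" and q
      using bundle_isomorphic_trans[OF iso] bundle_isomorphic_trans[OF bundle_isomorphic_sym[OF iso]]
      by blast
    then show ?thesis
      by (simp add: bundle_class_def)
  qed
  have ex_E: "\<exists>(E :: 'e topology) p. fiber_bundle B F E p \<and> bundle_isomorphic (?G C) groth_proj E p"
    if C: "aut_functor B F C" for C
  proof -
    have "inj_on i (topspace (?G C))"
      using assms(3) by (simp add: topspace_groth_aut[OF C])
    then show ?thesis
      using ex_bundle_isomorphic_copy fiber_bundle_bundle_isomorphic[OF fiber_bundle_groth[OF B C]]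
      by blast
  qed
  have ex_C: "\<exists>C. aut_functor B F C \<and> bundle_isomorphic (?G C) groth_proj E p"
    if E: "fiber_bundle B F E p" for E :: "'e topology" and p
    using canonical_rep_aut_functor[OF F E] isomorphic_canonical_rep_iff_groth[OF B F _ E] by blast
  have X: "\<Psi> (\<Phi> X) = X \<and> \<Phi> X \<in> functor_classes B F" if X: "X \<in> bundle_classes B F" for X
  proof -
    obtain E :: "'e topology" and p where E: "fiber_bundle B F E p" "X = bundle_class B F E p"
      using X by (auto simp: bundle_classes_def)
    obtain C where C: "aut_functor B F C" "bundle_isomorphic (?G C) groth_proj E p"
      using ex_C[OF E(1)] by blast
    show ?thesis
      using \<Phi>_eq[OF C(1) E(1) C(2)] \<Psi>_eq[OF C(1) E(1) C(2)] E(2) C(1) by (simp add: functor_classes_def)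
  qed
  have Y: "\<Phi> (\<Psi> Y) = Y \<and> \<Psi> Y \<in> bundle_classes B F" if Y: "Y \<in> functor_classes B F" for Y
  proof -
    obtain C where C: "aut_functor B F C" "Y = functor_class B F C"
      using Y by (auto simp: functor_classes_def)
    obtain E :: "'e topology" and p where E: "fiber_bundle B F E p" "bundle_isomorphic (?G C) groth_proj E p"
      using ex_E[OF C(1)] by blast
    show ?thesis
      using \<Phi>_eq[OF C(1) E] \<Psi>_eq[OF C(1) E] C(2) E(1) by (auto simp: bundle_classes_def)
  qed
  show ?thesis
  proof (intro exI[of _ \<Phi>] exI[of _ \<Psi>] conjI ballI allI impI)
    show "bij_betw \<Phi> (bundle_classes B F) (functor_classes B F)"
      by (rule bij_betw_byWitness[where f' = \<Psi>]) (use X Y in auto)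
    show "bij_betw \<Psi> (functor_classes B F) (bundle_classes B F)"
      by (rule bij_betw_byWitness[where f' = \<Phi>]) (use X Y in auto)
    show "\<Psi> (\<Phi> X) = X" if "X \<in> bundle_classes B F" for X
      using X[OF that] by simp
    show "\<Phi> (\<Psi> Y) = Y" if "Y \<in> functor_classes B F" for Y
      using Y[OF that] by simp
    show "\<exists>C. aut_functor B F C \<and> top_naturally_isomorphic B (aut_incl F C) (canonical_rep B F E p)"
      if "fiber_bundle B F E p" for E :: "'e topology" and p
      by (rule canonical_rep_aut_functor[OF F that])
    show "\<Phi> (bundle_class B F E p) = functor_class B F C"
      if E: "fiber_bundle B F E p" and
        C: "aut_functor B F C \<and> top_naturally_isomorphic B (aut_incl F C) (canonical_rep B F E p)"
      for E :: "'e topology" and p C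
      using \<Phi>_eq[of C E p] isomorphic_canonical_rep_iff_groth[OF B F _ E, of C] E C by blast
    show "fiber_bundle B F (?G C) groth_proj" if "aut_functor B F C" for C
      by (rule fiber_bundle_groth[OF B that])
    show "\<Psi> (functor_class B F C) = bundle_class B F (?G C) groth_proj" if C: "aut_functor B F C" for C
    proof -
      obtain E :: "'e topology" and p where E: "fiber_bundle B F E p" "bundle_isomorphic (?G C) groth_proj E p"
        using ex_E[OF C] by blast
      then show ?thesis
        using \<Psi>_eq[OF C E] class_eq[OF E(2)] by simp
    qed
  qed
qed

end
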